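(* Let $\eta$ and $\nu$ be nonnesting $\mathbb{F}_q$-set partitions of $[n]$ and let $g\in K_{[\nu]}$. Then $$\chi_{[\eta]}(g)=\chi_{[\eta]}(1)\prod_{\substack{i\overset{a}{\frown}j\in\eta\\ i\overset{b}{\frown}j\in\nu}}\theta(ab)$$ if there are no $i\overset{a}{\frown}j\in\eta$ and $k\overset{b}{\frown}l\in\nu$ with $(i,j)\neq(k,l)$ and $i\le k<l\le j$, and $\chi_{[\eta]}(g)=0$ otherwise. (The product runs over all pairs $(i,j)$ carrying an arc in both $\eta$, with label $a$, and $\nu$, with label $b$.)
   Context: $\mathbb{F}_q$ is the field with $q$ elements, $\theta:\mathbb{F}_q^+\to\mathbb{C}^\times$ is a fixed nontrivial homomorphism, $[n]=\{1,\dots,n\}$. $\mathfrak{ut}_n(\mathbb{F}_q)$ is the algebra of strictly upper triangular $n\times n$ matrices over $\mathbb{F}_q$ and $G=UT_n(\mathbb{F}_q)=1+\mathfrak{ut}_n(\mathbb{F}_q)$ the group of unipotent upper triangular matrices; $f:G\to\mathfrak{ut}_n(\mathbb{F}_q)$ is $f(1+x)=x$; $e_{ij}$ denotes the elementary matrix. $G$ acts on $\mathfrak{ut}_n(\mathbb{F}_q)$ by left and right multiplication and on the dual $\mathfrak{ut}_n(\mathbb{F}_q)^*$ by $(g\lambda)(x)=\lambda(g^{-1}x)$ and $(\lambda g)(x)=\lambda(xg^{-1})$. An $\mathbb{F}_q$-set partition of $[n]$ is a set $\eta$ of labeled arcs $i\overset{a}{\frown}j$ ($1\le i<j\le n$,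 $a\in\mathbb{F}_q^\times$, at most one label for each pair $(i,j)$) such that if $i\overset{a}{\frown}j\in\eta$ and $i<k<j$ then $\eta$ contains no arc from $i$ to $k$ and no arc from $k$ to $j$ (with any label). It is nonnesting if there are no $i<j<k<l$ such that $\eta$ has an arc from $i$ to $l$ and an arc from $j$ to $k$. For an $\mathbb{F}_q$-set partition $\eta$ put $\mathrm{sml}(\eta)=\{i\overset{a}{\frown}j\in\eta\mid\text{there are no }k\overset{b}{\frown}l\in\eta\text{ with }i<k<l<j\}$ and $\mathrm{big}(\eta)=\{i\overset{a}{\frown}j\in\eta\mid\text{there are no }k\overset{b}{\frown}l\in\eta\text{ with }k<i<j<l\}$; both are nonnesting. For an $\mathbb{F}_q$-set partition $\nu$ let $x_\nu=\sum_{i\overset{a}{\frown}j\in\nu}a e_{ij}$ and $\lambda_\nu(x)=\sum_{i\overset{a}{\frown}j\in\nu}a x_{ij}$ for $x\in\mathfrak{ut}_n(\mathbb{F}_q)$, and let $K_\nu=\{h\in G\mid f(h)\in G x_\nu G\}$ and $\chi_\nu=\sum_{\mu\in G\lambda_\nu G}\theta\circ\mu\circ f$. For a nonnesting $\mathbb{F}_q$-set partition $\eta$ define $$K_{[\eta]}=\bigcup_{\mathrm{sml}(\nu)=\eta}K_\nu,\qquad\chi_{[\eta]}=\sum_{\mathrm{big}(\nu)=\eta}\chi_\nu,$$ where $\nu$ runs over $\mathbb{F}_q$-set partitions of $[n]$. *)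

theory Defs
  imports
    Complex_Main
    "HOL-Algebra.Group"
    "HOL-Library.FuncSet"
    "Jordan_Normal_Form.Determinant"
begin

text \<open>
  Rows and columns of a matrix from \<open>Jordan_Normal_Form\<close> are numbered from 0, so throughout the
  index set \<open>[n]\<close> is \<open>{0..<n}\<close>; only the linear order on it matters. The field with \<open>q\<close> elements is a
  type \<open>'a\<close> of sort \<open>{field, finite}\<close>. A labelled arc from \<open>i\<close> to \<open>j\<close> with label \<open>a\<close> is the triple
  \<open>(i, j, a)\<close>.
\<close>

section \<open>Matrices, the group and its actions\<close>

definition ut :: "nat \<Rightarrow> 'a::field mat set" where
  "ut n = {x \<in> carrier_mat n n. \<forall>i<n. \<forall>j<n. j \<le> i \<longrightarrow> x $$ (i, j) = 0}"

definition UT :: "nat \<Rightarrow> 'a::field mat monoid" where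
  "UT n = \<lparr>carrier = {1\<^sub>m n + x | x. x \<in> ut n}, mult = (*), one = 1\<^sub>m n\<rparr>"

definition ut_part :: "nat \<Rightarrow> 'a::field mat \<Rightarrow> 'a mat" where
  "ut_part n g = g - 1\<^sub>m n"

definition elem_mat :: "nat \<Rightarrow> nat \<Rightarrow> nat \<Rightarrow> 'a::field mat" where
  "elem_mat n i j = mat n n (\<lambda>(k, l). if k = i \<and> l = j then 1 else 0)"

definition double_orbit :: "nat \<Rightarrow> 'a::field mat \<Rightarrow> 'a mat set" where
  "double_orbit n x = {g * x * h | g h. g \<in> carrier (UT n) \<and> h \<in> carrier (UT n)}"

text \<open>
  Functionals on \<open>ut n\<close> are \<open>undefined\<close> outside \<open>ut n\<close>, so that two of them are equal as HOL
  functions iff they agree on \<open>ut n\<close>. This matters because the characters below are sums over sets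
  of functionals.
\<close>

definition left_act :: "nat \<Rightarrow> 'a::field mat \<Rightarrow> ('a mat \<Rightarrow> 'a) \<Rightarrow> ('a mat \<Rightarrow> 'a)" where
  "left_act n g \<phi> = (\<lambda>x\<in>ut n. \<phi> (inv\<^bsub>UT n\<^esub> g * x))"

definition right_act :: "nat \<Rightarrow> ('a::field mat \<Rightarrow> 'a) \<Rightarrow> 'a mat \<Rightarrow> ('a mat \<Rightarrow> 'a)" where
  "right_act n \<phi> g = (\<lambda>x\<in>ut n. \<phi> (x * inv\<^bsub>UT n\<^esub> g))"

definition dual_double_orbit :: "nat \<Rightarrow> ('a::field mat \<Rightarrow> 'a) \<Rightarrow> ('a mat \<Rightarrow> 'a) set" where
  "dual_double_orbit n \<phi> =
     {right_act n (left_act n g \<phi>) h | g h. g \<in> carrier (UT n) \<and> h \<in> carrier (UT n)}"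

section \<open>Labelled set partitions\<close>

definition fq_set_partition :: "nat \<Rightarrow> (nat \<times> nat \<times> 'a::field) set \<Rightarrow> bool" where
  "fq_set_partition n \<eta> \<longleftrightarrow>
     (\<forall>i j a. (i, j, a) \<in> \<eta> \<longrightarrow> i < j \<and> j < n \<and> a \<noteq> 0) \<and>
     (\<forall>i j a b. (i, j, a) \<in> \<eta> \<and> (i, j, b) \<in> \<eta> \<longrightarrow> a = b) \<and>
     (\<forall>i j k a b. (i, j, a) \<in> \<eta> \<and> i < k \<and> k < j \<longrightarrow> (i, k, b) \<notin> \<eta> \<and> (k, j, b) \<notin> \<eta>)"

definition nonnesting :: "(nat \<times> nat \<times> 'a) set \<Rightarrow> bool" where
  "nonnesting \<eta> \<longleftrightarrow>
     \<not> (\<exists>i j k l a b. i < j \<and> j < k \<and> k < l \<and> (i, l, a) \<in> \<eta> \<and> (j, k, b) \<in> \<eta>)"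

definition sml :: "(nat \<times> nat \<times> 'a) set \<Rightarrow> (nat \<times> nat \<times> 'a) set" where
  "sml \<eta> = {(i, j, a) \<in> \<eta>. \<not> (\<exists>k l b. (k, l, b) \<in> \<eta> \<and> i < k \<and> k < l \<and> l < j)}"

definition big :: "(nat \<times> nat \<times> 'a) set \<Rightarrow> (nat \<times> nat \<times> 'a) set" where
  "big \<eta> = {(i, j, a) \<in> \<eta>. \<not> (\<exists>k l b. (k, l, b) \<in> \<eta> \<and> k < i \<and> i < j \<and> j < l)}"

section \<open>Superclasses and supercharacters\<close>

text \<open>
  The type of matrices carries no \<open>comm_monoid_add\<close> structure (the dimension is not part of the
  type), so the sum \<open>\<Sum> a e\<^sub>i\<^sub>j\<close> is taken entrywise.
\<close>

definition arc_mat :: "nat \<Rightarrow> (nat \<times> nat \<times> 'a::field) set \<Rightarrow> 'a mat" where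
  "arc_mat n \<nu> = mat n n (\<lambda>(k, l). \<Sum>(i, j, a)\<in>\<nu>. a * elem_mat n i j $$ (k, l))"

definition arc_fun :: "nat \<Rightarrow> (nat \<times> nat \<times> 'a::field) set \<Rightarrow> 'a mat \<Rightarrow> 'a" where
  "arc_fun n \<nu> = (\<lambda>x\<in>ut n. \<Sum>(i, j, a)\<in>\<nu>. a * x $$ (i, j))"

definition K :: "nat \<Rightarrow> (nat \<times> nat \<times> 'a::field) set \<Rightarrow> 'a mat set" where
  "K n \<nu> = {h \<in> carrier (UT n). ut_part n h \<in> double_orbit n (arc_mat n \<nu>)}"

definition chi ::
    "nat \<Rightarrow> ('a::{field,finite} \<Rightarrow> complex) \<Rightarrow> (nat \<times> nat \<times> 'a) set \<Rightarrow> 'a mat \<Rightarrow> complex" where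
  "chi n \<theta> \<nu> g = (\<Sum>\<mu>\<in>dual_double_orbit n (arc_fun n \<nu>). \<theta> (\<mu> (ut_part n g)))"

definition K_nonnest :: "nat \<Rightarrow> (nat \<times> nat \<times> 'a::field) set \<Rightarrow> 'a mat set" where
  "K_nonnest n \<eta> = (\<Union>\<nu>\<in>{\<nu>. fq_set_partition n \<nu> \<and> sml \<nu> = \<eta>}. K n \<nu>)"

definition chi_nonnest ::
    "nat \<Rightarrow> ('a::{field,finite} \<Rightarrow> complex) \<Rightarrow> (nat \<times> nat \<times> 'a) set \<Rightarrow> 'a mat \<Rightarrow> complex" where
  "chi_nonnest n \<theta> \<eta> g = (\<Sum>\<nu>\<in>{\<nu>. fq_set_partition n \<nu> \<and> big \<nu> = \<eta>}. chi n \<theta> \<nu> g)"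

section \<open>Well-definedness\<close>

text \<open>
  The inverse in the actions is that of a genuine group, and the two sums are over finite sets
  (a sum over an infinite set would be 0 by convention).
\<close>

lemma UT_iff:
  "g \<in> carrier (UT n) \<longleftrightarrow> g \<in> carrier_mat n n \<and>
     (\<forall>i<n. \<forall>j<n. j \<le> i \<longrightarrow> g $$ (i, j) = (if i = j then 1 else 0))"
  (is "?l \<longleftrightarrow> ?r")
proof
  assume ?l
  then show ?r by (auto simp: UT_def ut_def)
next
  assume r: ?r
  have "g = 1\<^sub>m n + (g - 1\<^sub>m n)" using r by (intro eq_matI) auto
  moreover have "g - 1\<^sub>m n \<in> ut n" using r by (auto simp: ut_def)
  ultimately show ?l by (auto simp: UT_def)
qed

lemma mult_UT:
  assumes "g \<in> carrier (UT n)" "h \<in> carrier (UT n)"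
  shows "g * h \<in> carrier (UT n)"
proof -
  have dims: "dim_row g = n" "dim_col g = n" "dim_row h = n" "dim_col h = n"
    using assms by (auto simp: UT_iff)
  have g0: "g $$ (i, k) = (if i = k then 1 else 0)" if "i < n" "k \<le> i" for i k
    using assms(1) that by (simp add: UT_iff)
  have h0: "h $$ (k, j) = (if k = j then 1 else 0)" if "k < n" "j \<le> k" for k j
    using assms(2) that by (simp add: UT_iff)
  have "(g * h) $$ (i, j) = (if i = j then 1 else 0)" if "i < n" "j < n" "j \<le> i" for i j
  proof -
    have "(g * h) $$ (i, j) = (\<Sum>k = 0..<n. g $$ (i, k) * h $$ (k, j))"
      using that dims by (simp add: scalar_prod_def)
    also have "\<dots> = (\<Sum>k = 0..<n. if k = i then (if i = j then 1 else 0) else 0)"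
    proof (rule sum.cong)
      fix k assume k: "k \<in> {0..<n}"
      consider "k < i" | "k = i" | "k > i" by linarith
      then show "g $$ (i, k) * h $$ (k, j) = (if k = i then (if i = j then 1 else 0) else 0)"
        using that k by cases (simp_all add: g0 h0)
    qed simp
    also have "\<dots> = (if i = j then 1 else 0)" using that by simp
    finally show ?thesis .
  qed
  moreover have "g * h \<in> carrier_mat n n" using dims by auto
  ultimately show ?thesis by (simp add: UT_iff)
qed

lemma finite_carrier_mat: "finite (carrier_mat n m :: 'a::finite mat set)"
proof (rule finite_surj)
  show "finite ({0..<n} \<times> {0..<m} \<rightarrow>\<^sub>E (UNIV :: 'a set))" by (intro finite_PiE) auto
  show "carrier_mat n m \<subseteq> mat n m ` ({0..<n} \<times> {0..<m} \<rightarrow>\<^sub>E (UNIV :: 'a set))"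
  proof
    fix A :: "'a mat" assume "A \<in> carrier_mat n m"
    then have "A = mat n m (restrict (\<lambda>ij. A $$ ij) ({0..<n} \<times> {0..<m}))"
      by (intro eq_matI) auto
    moreover have "restrict (\<lambda>ij. A $$ ij) ({0..<n} \<times> {0..<m}) \<in> {0..<n} \<times> {0..<m} \<rightarrow>\<^sub>E UNIV"
      by simp
    ultimately show "A \<in> mat n m ` ({0..<n} \<times> {0..<m} \<rightarrow>\<^sub>E UNIV)" by (rule image_eqI)
  qed
qed

lemma finite_UT: "finite (carrier (UT n :: 'a::{field,finite} mat monoid))"
  by (rule finite_subset[OF _ finite_carrier_mat[of n n]]) (auto simp: UT_iff)

lemma group_UT: "Group.group (UT n :: 'a::{field,finite} mat monoid)"
proof (rule Group.groupI)
  fix g :: "'a mat" assume g: "g \<in> carrier (UT n)"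
  have gc: "g \<in> carrier_mat n n" using g by (simp add: UT_iff)
  have gij: "g $$ (i, j) = (if i = j then 1 else 0)" if "i < n" "j \<le> i" for i j
    using g that by (simp add: UT_iff)
  have "upper_triangular g" using gc gij by auto
  then have "det g = prod_list (diag_mat g)"
    using gc by (rule det_upper_triangular)
  also have "diag_mat g = map (\<lambda>_. 1) [0..<n]"
    using gc gij by (simp add: diag_mat_def)
  finally have "det g \<noteq> 0" by (auto simp: prod_list_zero_iff)
  then obtain B where B: "B \<in> carrier_mat n n" "g * B = 1\<^sub>m n"
  proof -
    have "g \<in> Units (ring_mat TYPE('a) n ())"
      using gc \<open>det g \<noteq> 0\<close> by (rule det_non_zero_imp_unit)
    then show ?thesis using that by (auto simp: Units_def ring_mat_def)
  qed
  have inj: "inj_on (\<lambda>h. h * g) (carrier (UT n))"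
  proof (rule inj_onI)
    fix x y assume x: "x \<in> carrier (UT n)" and y: "y \<in> carrier (UT n)" and e: "x * g = y * g"
    have xc: "x \<in> carrier_mat n n" and yc: "y \<in> carrier_mat n n" using x y by (simp_all add: UT_iff)
    have "x = x * (g * B)" using xc B by simp
    also have "\<dots> = x * g * B" using xc gc B(1) by (rule assoc_mult_mat[symmetric])
    also have "\<dots> = y * (g * B)" unfolding e using yc gc B(1) by (rule assoc_mult_mat)
    also have "\<dots> = y" using yc B by simp
    finally show "x = y" .
  qed
  have "(\<lambda>h. h * g) ` carrier (UT n) = carrier (UT n)"
    by (rule endo_inj_surj[OF finite_UT _ inj]) (use g mult_UT in blast)
  moreover have "1\<^sub>m n \<in> carrier (UT n :: 'a mat monoid)" by (simp add: UT_iff)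
  ultimately have "\<exists>h\<in>carrier (UT n). h * g = 1\<^sub>m n" by (metis imageE)
  then show "\<exists>h\<in>carrier (UT n). h \<otimes>\<^bsub>UT n\<^esub> g = \<one>\<^bsub>UT n\<^esub>" by (simp add: UT_def)
next
  fix x y z :: "'a mat"
  assume "x \<in> carrier (UT n)" "y \<in> carrier (UT n)" "z \<in> carrier (UT n)"
  then have "x \<in> carrier_mat n n" "y \<in> carrier_mat n n" "z \<in> carrier_mat n n"
    by (simp_all add: UT_iff)
  then have "x * y * z = x * (y * z)" by (rule assoc_mult_mat)
  then show "x \<otimes>\<^bsub>UT n\<^esub> y \<otimes>\<^bsub>UT n\<^esub> z = x \<otimes>\<^bsub>UT n\<^esub> (y \<otimes>\<^bsub>UT n\<^esub> z)" by (simp add: UT_def)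
next
  fix x y :: "'a mat"
  assume "x \<in> carrier (UT n)" "y \<in> carrier (UT n)"
  then have "x * y \<in> carrier (UT n)" by (rule mult_UT)
  then show "x \<otimes>\<^bsub>UT n\<^esub> y \<in> carrier (UT n)" by (simp add: UT_def)
next
  have "1\<^sub>m n \<in> carrier (UT n :: 'a mat monoid)" by (simp add: UT_iff)
  then show "\<one>\<^bsub>UT n\<^esub> \<in> carrier (UT n :: 'a mat monoid)" by (simp add: UT_def)
next
  fix x :: "'a mat" assume "x \<in> carrier (UT n)"
  then have "x \<in> carrier_mat n n" by (simp add: UT_iff)
  then have "1\<^sub>m n * x = x" by simp
  then show "\<one>\<^bsub>UT n\<^esub> \<otimes>\<^bsub>UT n\<^esub> x = x" by (simp add: UT_def)
qed

lemma finite_dual_double_orbit: "finite (dual_double_orbit n (\<phi> :: 'a::{field,finite} mat \<Rightarrow> 'a))"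
proof -
  have "dual_double_orbit n \<phi> =
      (\<lambda>(g, h). right_act n (left_act n g \<phi>) h) ` (carrier (UT n) \<times> carrier (UT n))"
    by (auto simp: dual_double_orbit_def)
  then show ?thesis by (simp add: finite_UT)
qed

lemma finite_fq_set_partitions:
  "finite {\<nu> :: (nat \<times> nat \<times> 'a::{field,finite}) set. fq_set_partition n \<nu>}"
proof (rule finite_subset)
  show "{\<nu> :: (nat \<times> nat \<times> 'a) set. fq_set_partition n \<nu>} \<subseteq> Pow ({..<n} \<times> {..<n} \<times> UNIV)"
    unfolding fq_set_partition_def by (auto intro: less_trans)
qed simp

end

theory Submission
  imports Defs
begin

text \<open>
  Let \<open>m\<close> be the coefficient array of a functional. The double coset action moves coefficients only
  inwards, from \<open>(i, l)\<close> to \<open>(j, k)\<close> with \<open>i \<le> j < k \<le> l\<close>, so the outermost nonzero entries of \<open>m\<close> are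
  invariants, and on the orbit of \<open>\<lambda>\<^sub>\<nu>\<close> they are the arcs of \<open>big \<nu>\<close>. Since the orbits of the \<open>\<lambda>\<^sub>\<nu>\<close>
  partition the dual space, the orbits with \<open>big \<nu> = \<eta>\<close> together consist of all functionals whose
  outermost entries form \<open>\<eta>\<close>: coefficients are prescribed on the arcs of \<open>\<eta>\<close>, free strictly inside
  them, and zero elsewhere. The sum of \<open>\<theta>\<close> over this product set factorises over positions, and a free
  coefficient at a position where \<open>x = g - 1\<close> is nonzero makes the sum vanish. Dually, the innermost
  nonzero entries of \<open>x\<close> are the arcs of \<open>\<nu>\<close>, so such a position exists iff some arc of \<open>\<nu>\<close> lies
  strictly inside an arc of \<open>\<eta>\<close>.
\<close>

section \<open>Coefficient arrays and arc labels\<close>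

definition positions :: "nat \<Rightarrow> (nat \<times> nat) set" where
  "positions n = {(i, j). i < j \<and> j < n}"

lemma positions_iff [simp]: "(i, j) \<in> positions n \<longleftrightarrow> i < j \<and> j < n"
  by (simp add: positions_def)

lemma finite_positions [simp]: "finite (positions n)"
  by (rule finite_subset[of _ "{..<n} \<times> {..<n}"]) (auto simp: positions_def)

text \<open>Extensional like \<open>arc_fun\<close>, so that arrays agreeing on
  \<open>positions n\<close> give equal HOL functions.\<close>

definition coeff_fun :: "nat \<Rightarrow> (nat \<times> nat \<Rightarrow> 'a::field) \<Rightarrow> 'a mat \<Rightarrow> 'a" where
  "coeff_fun n m = (\<lambda>x\<in>ut n. \<Sum>p\<in>positions n. m p * x $$ p)"

text \<open>In a set partition the default 0 is never a label, so the support records exactly which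
  pairs carry an arc.\<close>

definition arc_label :: "(nat \<times> nat \<times> 'a::field) set \<Rightarrow> nat \<times> nat \<Rightarrow> 'a" where
  "arc_label \<nu> p = (if \<exists>a. (fst p, snd p, a) \<in> \<nu> then THE a. (fst p, snd p, a) \<in> \<nu> else 0)"

lemma fq_set_partitionD:
  assumes "fq_set_partition n \<nu>" "(i, j, a) \<in> \<nu>"
  shows "i < j" "j < n" "a \<noteq> 0" "(i, j) \<in> positions n"
proof -
  show "i < j" "j < n" "a \<noteq> 0" using assms unfolding fq_set_partition_def by blast+
  then show "(i, j) \<in> positions n" by simp
qed

lemma fq_set_partition_unique:
  "fq_set_partition n \<nu> \<Longrightarrow> (i, j, a) \<in> \<nu> \<Longrightarrow> (i, j, b) \<in> \<nu> \<Longrightarrow> a = b"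
  unfolding fq_set_partition_def by blast

lemma fq_set_partition_between:
  "fq_set_partition n \<nu> \<Longrightarrow> (i, j, a) \<in> \<nu> \<Longrightarrow> i < k \<Longrightarrow> k < j \<Longrightarrow> (i, k, b) \<notin> \<nu> \<and> (k, j, b) \<notin> \<nu>"
  unfolding fq_set_partition_def by blast

text \<open>Of two different arcs leaving \<open>i\<close>, the shorter one would end between the
  endpoints of the longer one, which is forbidden.\<close>

lemma fq_set_partition_row:
  assumes p: "fq_set_partition n \<nu>" and a: "(i, j, a) \<in> \<nu>" and b: "(i, l, b) \<in> \<nu>"
  shows "j = l \<and> a = b"
proof (cases j l rule: linorder_cases)
  case less
  then show ?thesis
    using fq_set_partition_between[OF p b _ less] fq_set_partitionD(1)[OF p a] a by blast
next
  case equal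
  then show ?thesis using fq_set_partition_unique[OF p a] b by blast
next
  case greater
  then show ?thesis
    using fq_set_partition_between[OF p a _ greater] fq_set_partitionD(1)[OF p b] b by blast
qed

lemma fq_set_partition_col:
  assumes p: "fq_set_partition n \<nu>" and a: "(i, j, a) \<in> \<nu>" and b: "(k, j, b) \<in> \<nu>"
  shows "i = k \<and> a = b"
proof (cases i k rule: linorder_cases)
  case less
  then show ?thesis
    using fq_set_partition_between[OF p a less] fq_set_partitionD(1)[OF p b] b by blast
next
  case equal
  then show ?thesis using fq_set_partition_unique[OF p a] b by blast
next
  case greater
  then show ?thesis
    using fq_set_partition_between[OF p b greater] fq_set_partitionD(1)[OF p a] a by blast
qed

lemma arc_label_eq:
  assumes "fq_set_partition n \<nu>" "(i, j, a) \<in> \<nu>"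
  shows "arc_label \<nu> (i, j) = a"
proof -
  have "(THE a. (i, j, a) \<in> \<nu>) = a"
    using assms(2) fq_set_partition_unique[OF assms(1)] by (intro the_equality) blast+
  then show ?thesis using assms(2) by (auto simp: arc_label_def)
qed

lemma arc_label_nonzero_iff:
  assumes p: "fq_set_partition n \<nu>"
  shows "arc_label \<nu> (i, j) \<noteq> 0 \<longleftrightarrow> (i, j, arc_label \<nu> (i, j)) \<in> \<nu>"
proof
  assume "arc_label \<nu> (i, j) \<noteq> 0"
  then obtain a where a: "(i, j, a) \<in> \<nu>" by (auto simp: arc_label_def split: if_splits)
  then show "(i, j, arc_label \<nu> (i, j)) \<in> \<nu>" using arc_label_eq[OF p a] by simp
next
  assume "(i, j, arc_label \<nu> (i, j)) \<in> \<nu>"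
  then show "arc_label \<nu> (i, j) \<noteq> 0" by (rule fq_set_partitionD(3)[OF p])
qed

text \<open>A set partition is the graph of its label function over the support. With
  \<open>f\<close> general, one reindexing serves both \<open>arc_fun\<close> and
  \<open>arc_mat\<close>.\<close>

lemma sum_arcs:
  assumes p: "fq_set_partition n \<nu>"
  shows "(\<Sum>(i, j, a)\<in>\<nu>. a * f (i, j)) = (\<Sum>p\<in>positions n. arc_label \<nu> p * f p)"
proof -
  let ?h = "\<lambda>p. (fst p, snd p, arc_label \<nu> p)"
  let ?A = "{p \<in> positions n. arc_label \<nu> p \<noteq> 0}"
  have img: "\<nu> = ?h ` ?A"
  proof (intro equalityI subsetI)
    fix t assume t: "t \<in> \<nu>"
    obtain i j a where [simp]: "t = (i, j, a)" by (cases t) auto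
    have "arc_label \<nu> (i, j) = a" using t arc_label_eq[OF p] by simp
    moreover have "(i, j) \<in> positions n" "a \<noteq> 0" using t fq_set_partitionD(3,4)[OF p, of i j a] by simp_all
    ultimately show "t \<in> ?h ` ?A" by (intro image_eqI[of _ _ "(i, j)"]) auto
  qed (auto simp: arc_label_nonzero_iff[OF p])
  have "(\<Sum>(i, j, a)\<in>\<nu>. a * f (i, j)) = (\<Sum>p\<in>?A. arc_label \<nu> p * f p)"
    by (subst img, subst sum.reindex) (auto simp: inj_on_def prod_eq_iff case_prod_beta)
  also have "\<dots> = (\<Sum>p\<in>positions n. arc_label \<nu> p * f p)"
    by (intro sum.mono_neutral_left) auto
  finally show ?thesis .
qed

lemma arc_fun_eq_coeff_fun: "fq_set_partition n \<nu> \<Longrightarrow> arc_fun n \<nu> = coeff_fun n (arc_label \<nu>)"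
  unfolding arc_fun_def coeff_fun_def by (intro restrict_ext sum_arcs)

lemma arc_mat_carrier: "arc_mat n \<nu> \<in> carrier_mat n n"
  by (simp add: arc_mat_def)

lemma arc_mat_entry:
  assumes p: "fq_set_partition n \<nu>" and ij: "i < n" "j < n"
  shows "arc_mat n \<nu> $$ (i, j) = arc_label \<nu> (i, j)"
proof -
  have "arc_mat n \<nu> $$ (i, j) = (\<Sum>p\<in>positions n. arc_label \<nu> p * elem_mat n (fst p) (snd p) $$ (i, j))"
    using ij sum_arcs[OF p, of "\<lambda>q. elem_mat n (fst q) (snd q) $$ (i, j)"] by (simp add: arc_mat_def)
  also have "\<dots> = (\<Sum>p\<in>positions n. if p = (i, j) then arc_label \<nu> p else 0)"
    using ij by (intro sum.cong) (auto simp: elem_mat_def)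
  also have "\<dots> = arc_label \<nu> (i, j)"
    using fq_set_partitionD(4)[OF p] arc_label_nonzero_iff[OF p, of i j] by auto
  finally show ?thesis .
qed

lemma arc_mat_ut: "fq_set_partition n \<nu> \<Longrightarrow> arc_mat n \<nu> \<in> ut n"
  unfolding ut_def
  using arc_label_nonzero_iff[of n \<nu>] fq_set_partitionD(1)[of n \<nu>]
  by (simp add: arc_mat_carrier arc_mat_entry) (metis leD)

section \<open>Orbits of coefficient functionals\<close>

lemma UT_entry:
  "g \<in> carrier (UT n) \<Longrightarrow> i < n \<Longrightarrow> j \<le> i \<Longrightarrow> g $$ (i, j) = (if i = j then 1 else 0)"
  by (simp add: UT_iff)

lemma UT_entry_nonzero:
  assumes "g \<in> carrier (UT n)" "i < n" "g $$ (i, j) \<noteq> 0"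
  shows "i \<le> j"
  using assms UT_entry[OF assms(1,2), of j] by (cases "i \<le> j") auto

lemma UT_carrier: "g \<in> carrier (UT n) \<Longrightarrow> g \<in> carrier_mat n n"
  by (simp add: UT_iff)

lemma ut_carrier: "x \<in> ut n \<Longrightarrow> x \<in> carrier_mat n n"
  by (simp add: ut_def)

lemma one_UT: "1\<^sub>m n \<in> carrier (UT n)"
  by (simp add: UT_iff)

lemma UT_mult_ut:
  assumes g: "g \<in> carrier (UT n)" and x: "x \<in> ut n"
  shows "g * x \<in> ut n"
proof -
  have "(g * x) $$ (i, j) = 0" if ij: "i < n" "j < n" "j \<le> i" for i j
  proof -
    have "g $$ (i, k) * x $$ (k, j) = 0" if "k < n" for k
      using that ij g x by (cases "k < i") (auto simp: UT_iff ut_def)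
    then show ?thesis using ij UT_carrier[OF g] ut_carrier[OF x] by (auto simp: scalar_prod_def intro!: sum.neutral)
  qed
  then show ?thesis using UT_carrier[OF g] ut_carrier[OF x] by (auto simp: ut_def)
qed

lemma ut_mult_UT:
  assumes g: "g \<in> carrier (UT n)" and x: "x \<in> ut n"
  shows "x * g \<in> ut n"
proof -
  have "(x * g) $$ (i, j) = 0" if ij: "i < n" "j < n" "j \<le> i" for i j
  proof -
    have "x $$ (i, k) * g $$ (k, j) = 0" if "k < n" for k
      using that ij g x by (cases "k \<le> i") (auto simp: UT_iff ut_def)
    then show ?thesis using ij UT_carrier[OF g] ut_carrier[OF x] by (auto simp: scalar_prod_def intro!: sum.neutral)
  qed
  then show ?thesis using UT_carrier[OF g] ut_carrier[OF x] by (auto simp: ut_def)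
qed

lemma mult_mult_entry:
  assumes "g \<in> carrier_mat n n" "x \<in> ut n" "h \<in> carrier_mat n n" "k < n" "l < n"
  shows "(g * x * h) $$ (k, l) = (\<Sum>(i, j)\<in>positions n. g $$ (k, i) * x $$ (i, j) * h $$ (j, l))"
proof -
  have zero: "x $$ (i, j) = 0" if "i < n" "j < n" "\<not> i < j" for i j
    using assms(2) that by (simp add: ut_def)
  have "(g * x * h) $$ (k, l) = (\<Sum>j<n. \<Sum>i<n. g $$ (k, i) * x $$ (i, j) * h $$ (j, l))"
    using assms ut_carrier[OF assms(2)]
    by (simp add: scalar_prod_def sum_distrib_right atLeast0LessThan del: assoc_mult_mat)
  also have "\<dots> = (\<Sum>(i, j)\<in>{..<n} \<times> {..<n}. g $$ (k, i) * x $$ (i, j) * h $$ (j, l))"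
    by (subst sum.swap) (simp add: sum.cartesian_product)
  also have "\<dots> = (\<Sum>(i, j)\<in>positions n. g $$ (k, i) * x $$ (i, j) * h $$ (j, l))"
  proof (intro sum.mono_neutral_right ballI)
    fix p assume p: "p \<in> {..<n} \<times> {..<n} - positions n"
    obtain i j where [simp]: "p = (i, j)" by (cases p)
    have "i < n" "j < n" "\<not> i < j" using p by auto
    then have "x $$ p = 0" by (simp add: zero)
    then show "(case p of (i, j) \<Rightarrow> g $$ (k, i) * x $$ (i, j) * h $$ (j, l)) = 0"
      by (simp add: case_prod_beta)
  qed (auto simp: positions_def)
  finally show ?thesis .
qed

text \<open>The entries are those of the matrix product of \<open>g\<close> transposed,
  \<open>m\<close> cut off to \<open>positions n\<close>, and \<open>h\<close> transposed.\<close>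

definition coeff_act :: "nat \<Rightarrow> 'a::field mat \<Rightarrow> 'a mat \<Rightarrow> (nat \<times> nat \<Rightarrow> 'a) \<Rightarrow> nat \<times> nat \<Rightarrow> 'a" where
  "coeff_act n g h m = (\<lambda>(i, j). \<Sum>(k, l)\<in>positions n. m (k, l) * g $$ (k, i) * h $$ (j, l))"

text \<open>The two-sided action freed of inverses; \<open>dual_double_orbit_eq\<close> justifies
  the exchange.\<close>

definition translate :: "nat \<Rightarrow> 'a::field mat \<Rightarrow> 'a mat \<Rightarrow> ('a mat \<Rightarrow> 'a) \<Rightarrow> 'a mat \<Rightarrow> 'a" where
  "translate n g h \<phi> = (\<lambda>x\<in>ut n. \<phi> (g * x * h))"

lemma translate_coeff_fun:
  assumes g: "g \<in> carrier (UT n)" and h: "h \<in> carrier (UT n)"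
  shows "translate n g h (coeff_fun n m) = coeff_fun n (coeff_act n g h m)"
  unfolding translate_def coeff_fun_def
proof (rule restrict_ext)
  fix x :: "'a mat" assume x: "x \<in> ut n"
  have "g * x * h \<in> ut n" using g h x by (intro ut_mult_UT UT_mult_ut)
  then have "(\<lambda>x\<in>ut n. \<Sum>p\<in>positions n. m p * x $$ p) (g * x * h)
      = (\<Sum>(k, l)\<in>positions n. m (k, l) * (g * x * h) $$ (k, l))"
    by (simp add: case_prod_beta)
  also have "\<dots> = (\<Sum>(k, l)\<in>positions n. \<Sum>(i, j)\<in>positions n.
      m (k, l) * g $$ (k, i) * h $$ (j, l) * x $$ (i, j))"
  proof (intro sum.cong refl, clarify)
    fix k l assume "(k, l) \<in> positions n"
    then show "m (k, l) * (g * x * h) $$ (k, l) = (\<Sum>(i, j)\<in>positions n.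
      m (k, l) * g $$ (k, i) * h $$ (j, l) * x $$ (i, j))"
      using mult_mult_entry[OF UT_carrier[OF g] x UT_carrier[OF h], of k l]
      by (simp add: sum_distrib_left case_prod_beta mult_ac)
  qed
  also have "\<dots> = (\<Sum>(i, j)\<in>positions n. coeff_act n g h m (i, j) * x $$ (i, j))"
    unfolding coeff_act_def by (simp add: case_prod_beta sum_distrib_right) (rule sum.swap)
  finally show "(\<lambda>x\<in>ut n. \<Sum>p\<in>positions n. m p * x $$ p) (g * x * h)
      = (\<Sum>p\<in>positions n. coeff_act n g h m p * x $$ p)"
    by (simp add: case_prod_beta)
qed

section \<open>Orbits as equivalence classes\<close>

lemma UT_inverse:
  assumes g: "g \<in> carrier (UT n :: 'a::{field,finite} mat monoid)"
  obtains g' where "g' \<in> carrier (UT n)" "g * g' = 1\<^sub>m n" "g' * g = 1\<^sub>m n"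
proof -
  interpret group "UT n :: 'a mat monoid" by (rule group_UT)
  let ?g' = "inv\<^bsub>UT n\<^esub> g"
  have "?g' \<in> carrier (UT n)" "g \<otimes>\<^bsub>UT n\<^esub> ?g' = \<one>\<^bsub>UT n\<^esub>" "?g' \<otimes>\<^bsub>UT n\<^esub> g = \<one>\<^bsub>UT n\<^esub>"
    using g by simp_all
  moreover have "mult (UT n) = ((*) :: 'a mat \<Rightarrow> _)" "\<one>\<^bsub>UT n\<^esub> = (1\<^sub>m n :: 'a mat)"
    by (simp_all add: UT_def)
  ultimately show ?thesis using that[of ?g'] by metis
qed

text \<open>Inversion permutes the group, so letting \<open>g\<close> and \<open>h\<close> range
  over all of it absorbs the inverses in the two actions.\<close>

lemma dual_double_orbit_eq:
  fixes \<phi> :: "'a::{field,finite} mat \<Rightarrow> 'a"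
  shows "dual_double_orbit n \<phi> = {translate n g h \<phi> | g h. g \<in> carrier (UT n) \<and> h \<in> carrier (UT n)}"
proof -
  interpret group "UT n :: 'a mat monoid" by (rule group_UT)
  have *: "right_act n (left_act n g \<phi>) h = translate n (inv\<^bsub>UT n\<^esub> g) (inv\<^bsub>UT n\<^esub> h) \<phi>"
    if "g \<in> carrier (UT n)" "h \<in> carrier (UT n)" for g h
    unfolding right_act_def left_act_def translate_def
  proof (rule restrict_ext)
    fix x :: "'a mat" assume x: "x \<in> ut n"
    have i: "inv\<^bsub>UT n\<^esub> g \<in> carrier (UT n)" "inv\<^bsub>UT n\<^esub> h \<in> carrier (UT n)" using that by auto
    show "(\<lambda>x\<in>ut n. \<phi> (inv\<^bsub>UT n\<^esub> g * x)) (x * inv\<^bsub>UT n\<^esub> h)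
        = \<phi> (inv\<^bsub>UT n\<^esub> g * x * inv\<^bsub>UT n\<^esub> h)"
      using ut_mult_UT[OF i(2) x] assoc_mult_mat[OF UT_carrier[OF i(1)] ut_carrier[OF x] UT_carrier[OF i(2)]]
      by simp
  qed
  show ?thesis
  proof (intro equalityI subsetI)
    fix \<psi> assume "\<psi> \<in> dual_double_orbit n \<phi>"
    then show "\<psi> \<in> {translate n g h \<phi> | g h. g \<in> carrier (UT n) \<and> h \<in> carrier (UT n)}"
      unfolding dual_double_orbit_def using * by fastforce
  next
    fix \<psi> assume "\<psi> \<in> {translate n g h \<phi> | g h. g \<in> carrier (UT n) \<and> h \<in> carrier (UT n)}"
    then obtain g h where "g \<in> carrier (UT n)" "h \<in> carrier (UT n)" "\<psi> = translate n g h \<phi>" by auto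
    then have "\<psi> = right_act n (left_act n (inv\<^bsub>UT n\<^esub> g) \<phi>) (inv\<^bsub>UT n\<^esub> h)"
      "inv\<^bsub>UT n\<^esub> g \<in> carrier (UT n)" "inv\<^bsub>UT n\<^esub> h \<in> carrier (UT n)"
      using *[of "inv\<^bsub>UT n\<^esub> g" "inv\<^bsub>UT n\<^esub> h"] by simp_all
    then show "\<psi> \<in> dual_double_orbit n \<phi>"
      unfolding dual_double_orbit_def by blast
  qed
qed

lemma translate_in_orbit:
  fixes \<phi> :: "'a::{field,finite} mat \<Rightarrow> 'a"
  shows "g \<in> carrier (UT n) \<Longrightarrow> h \<in> carrier (UT n) \<Longrightarrow> translate n g h \<phi> \<in> dual_double_orbit n \<phi>"
  unfolding dual_double_orbit_eq by blast

lemma translate_one: "translate n (1\<^sub>m n) (1\<^sub>m n) (coeff_fun n m) = coeff_fun n m"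
proof -
  have "1\<^sub>m n * x * 1\<^sub>m n = x" if "x \<in> ut n" for x :: "'a mat"
    using ut_carrier[OF that] by simp
  then show ?thesis unfolding translate_def by (intro ext) (simp add: coeff_fun_def)
qed

lemma translate_translate:
  assumes "g \<in> carrier (UT n)" "h \<in> carrier (UT n)" "g' \<in> carrier (UT n)" "h' \<in> carrier (UT n)"
  shows "translate n g' h' (translate n g h \<phi>) = translate n (g * g') (h' * h) \<phi>"
  unfolding translate_def
proof (rule restrict_ext)
  fix x :: "'a mat" assume x: "x \<in> ut n"
  note c = assms[THEN UT_carrier] ut_carrier[OF x]
  have "g * (g' * x * h') * h = g * g' * x * (h' * h)"
    using c by (simp add: assoc_mult_mat[of _ n n _ n _ n])
  moreover have "g' * x * h' \<in> ut n" using assms x by (intro ut_mult_UT UT_mult_ut)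
  ultimately show "(\<lambda>x\<in>ut n. \<phi> (g * x * h)) (g' * x * h') = \<phi> (g * g' * x * (h' * h))" by simp
qed

lemma orbit_refl: "coeff_fun n m \<in> dual_double_orbit n (coeff_fun n m :: 'a::{field,finite} mat \<Rightarrow> 'a)"
  using translate_in_orbit[OF one_UT one_UT, of n "coeff_fun n m"] by (simp add: translate_one)

lemma orbit_trans:
  fixes \<phi> :: "'a::{field,finite} mat \<Rightarrow> 'a"
  assumes "\<psi> \<in> dual_double_orbit n \<phi>" "\<xi> \<in> dual_double_orbit n \<psi>"
  shows "\<xi> \<in> dual_double_orbit n \<phi>"
  using assms unfolding dual_double_orbit_eq
  by clarify (metis translate_translate mult_UT)

text \<open>Translating by the inverses undoes the move. The base point is a
  \<open>coeff_fun\<close> because translation by the identity returns only functionals that are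
  extensional on \<open>ut n\<close>.\<close>

lemma orbit_sym:
  assumes "\<psi> \<in> dual_double_orbit n (coeff_fun n m :: 'a::{field,finite} mat \<Rightarrow> 'a)"
  shows "coeff_fun n m \<in> dual_double_orbit n \<psi>"
proof -
  obtain g h where gh: "g \<in> carrier (UT n)" "h \<in> carrier (UT n)" "\<psi> = translate n g h (coeff_fun n m)"
    using assms unfolding dual_double_orbit_eq by auto
  obtain g' where g': "g' \<in> carrier (UT n)" "g * g' = 1\<^sub>m n" using UT_inverse gh(1) by metis
  obtain h' where h': "h' \<in> carrier (UT n)" "h' * h = 1\<^sub>m n" using UT_inverse gh(2) by metis
  have "translate n g' h' \<psi> = coeff_fun n m"
    using gh g' h' by (simp add: translate_translate translate_one)
  then show ?thesis using translate_in_orbit[OF g'(1) h'(1), of \<psi>] by simp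
qed

lemma coeff_fun_elem_mat:
  fixes m :: "nat \<times> nat \<Rightarrow> 'a::field"
  assumes "(i, j) \<in> positions n"
  shows "coeff_fun n m (elem_mat n i j) = m (i, j)"
proof -
  have "elem_mat n i j \<in> (ut n :: 'a mat set)" using assms by (auto simp: ut_def elem_mat_def)
  then have "coeff_fun n m (elem_mat n i j) = (\<Sum>p\<in>positions n. m p * elem_mat n i j $$ p)"
    by (simp add: coeff_fun_def)
  also have "\<dots> = (\<Sum>p\<in>positions n. if p = (i, j) then m p else 0)"
    by (intro sum.cong) (auto simp: elem_mat_def positions_def split: if_splits)
  finally show ?thesis using assms by simp
qed

lemma coeff_fun_eq_iff: "coeff_fun n m = coeff_fun n m' \<longleftrightarrow> (\<forall>p\<in>positions n. m p = m' p)"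
proof
  assume e: "coeff_fun n m = coeff_fun n m'"
  show "\<forall>p\<in>positions n. m p = m' p"
  proof
    fix p assume "p \<in> positions n"
    then show "m p = m' p"
      using coeff_fun_elem_mat[of "fst p" "snd p" n m] coeff_fun_elem_mat[of "fst p" "snd p" n m'] e by simp
  qed
qed (auto simp: coeff_fun_def)

section \<open>Disjointness of the orbits\<close>

text \<open>A trivial factor collapses the double sum, so the left action mixes only entries of one
  column and, in \<open>coeff_act_one_left\<close>, the right action only entries of one
  row.\<close>

lemma coeff_act_one_right:
  assumes "(i, j) \<in> positions n"
  shows "coeff_act n g (1\<^sub>m n) m (i, j) = (\<Sum>k<j. m (k, j) * g $$ (k, i))"
proof -
  have "coeff_act n g (1\<^sub>m n) m (i, j) = (\<Sum>p\<in>(\<lambda>k. (k, j)) ` {..<j}. m p * g $$ (fst p, i))"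
    unfolding coeff_act_def prod.case using assms
    by (intro sum.mono_neutral_cong_right) (auto simp: image_iff)
  also have "\<dots> = (\<Sum>k<j. m (k, j) * g $$ (k, i))"
    by (subst sum.reindex) (auto simp: inj_on_def)
  finally show ?thesis .
qed

lemma coeff_act_one_left:
  assumes "(i, j) \<in> positions n"
  shows "coeff_act n (1\<^sub>m n) h m (i, j) = (\<Sum>l\<in>{i<..<n}. m (i, l) * h $$ (j, l))"
proof -
  have "coeff_act n (1\<^sub>m n) h m (i, j) = (\<Sum>p\<in>(\<lambda>l. (i, l)) ` {i<..<n}. m p * h $$ (j, snd p))"
    unfolding coeff_act_def prod.case using assms
    by (intro sum.mono_neutral_cong_right) (auto simp: image_iff)
  also have "\<dots> = (\<Sum>l\<in>{i<..<n}. m (i, l) * h $$ (j, l))"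
    by (subst sum.reindex) (auto simp: inj_on_def)
  finally show ?thesis .
qed

text \<open>Column \<open>j\<close> holds no other arc of \<open>\<nu>\<close>, and the diagonal
  entry of \<open>g\<close> is 1.\<close>

lemma coeff_act_col_arc:
  assumes \<nu>: "fq_set_partition n \<nu>" and g: "g \<in> carrier (UT n)" and a: "(i, j, a) \<in> \<nu>"
  shows "coeff_act n g (1\<^sub>m n) (arc_label \<nu>) (i, j) = a"
proof -
  note ij = fq_set_partitionD[OF \<nu> a]
  have "arc_label \<nu> (k, j) = 0" if "k \<noteq> i" for k
    using that arc_label_nonzero_iff[OF \<nu>] fq_set_partition_col[OF \<nu> a] by metis
  then have "(\<Sum>k<j. arc_label \<nu> (k, j) * g $$ (k, i)) = (\<Sum>k<j. if k = i then a else 0)"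
    using ij g arc_label_eq[OF \<nu> a] by (intro sum.cong) (auto simp: UT_entry)
  then show ?thesis using ij by (simp add: coeff_act_one_right)
qed

lemma coeff_act_row_arc:
  assumes \<nu>: "fq_set_partition n \<nu>" and h: "h \<in> carrier (UT n)" and a: "(i, j, a) \<in> \<nu>"
  shows "coeff_act n (1\<^sub>m n) h (arc_label \<nu>) (i, j) = a"
proof -
  note ij = fq_set_partitionD[OF \<nu> a]
  have "arc_label \<nu> (i, l) = 0" if "l \<noteq> j" for l
    using that arc_label_nonzero_iff[OF \<nu>] fq_set_partition_row[OF \<nu> a] by metis
  then have "(\<Sum>l\<in>{i<..<n}. arc_label \<nu> (i, l) * h $$ (j, l)) = (\<Sum>l\<in>{i<..<n}. if l = j then a else 0)"
    using ij h arc_label_eq[OF \<nu> a] by (intro sum.cong) (auto simp: UT_entry)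
  then show ?thesis using ij by (simp add: coeff_act_one_left)
qed

text \<open>Since \<open>g\<close> vanishes below the diagonal, an arc in column \<open>j\<close>
  contributes only if it starts no later than \<open>i\<close>.\<close>

lemma coeff_act_col_nonzero:
  assumes \<nu>: "fq_set_partition n \<nu>" and g: "g \<in> carrier (UT n)" and ij: "(i, j) \<in> positions n"
    and nz: "coeff_act n g (1\<^sub>m n) (arc_label \<nu>) (i, j) \<noteq> 0"
  obtains k a where "(k, j, a) \<in> \<nu>" "k \<le> i"
proof -
  obtain k where k: "k < j" "arc_label \<nu> (k, j) * g $$ (k, i) \<noteq> 0"
    using nz unfolding coeff_act_one_right[OF ij] by (auto elim: sum.not_neutral_contains_not_neutral)
  have "g $$ (k, i) = 0" if "i < k" using that k(1) ij g by (simp add: UT_iff)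
  then have "k \<le> i" using k(2) by force
  moreover have "(k, j, arc_label \<nu> (k, j)) \<in> \<nu>" using k(2) arc_label_nonzero_iff[OF \<nu>] by auto
  ultimately show ?thesis using that by blast
qed

lemma coeff_act_row_nonzero:
  assumes \<nu>: "fq_set_partition n \<nu>" and h: "h \<in> carrier (UT n)" and ij: "(i, j) \<in> positions n"
    and nz: "coeff_act n (1\<^sub>m n) h (arc_label \<nu>) (i, j) \<noteq> 0"
  obtains l a where "(i, l, a) \<in> \<nu>" "j \<le> l"
proof -
  obtain l where l: "l \<in> {i<..<n}" "arc_label \<nu> (i, l) * h $$ (j, l) \<noteq> 0"
    using nz unfolding coeff_act_one_left[OF ij] by (auto elim: sum.not_neutral_contains_not_neutral)
  have "h $$ (j, l) = 0" if "l < j" using that l(1) ij h by (simp add: UT_iff)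
  then have "j \<le> l" using l(2) by force
  moreover have "(i, l, arc_label \<nu> (i, l)) \<in> \<nu>" using l(2) arc_label_nonzero_iff[OF \<nu>] by auto
  ultimately show ?thesis using that by blast
qed

text \<open>
  If \<open>\<lambda>\<^bsub>\<nu>'\<^esub>(x) = \<lambda>\<^sub>\<nu>(g x h)\<close>, then \<open>\<lambda>\<^bsub>\<nu>'\<^esub>(x h') = \<lambda>\<^sub>\<nu>(g x)\<close> with \<open>h' = h\<inverse>\<close>. At
  \<open>e\<^sub>i\<^sub>j\<close> the left side sees only the arc of \<open>\<nu>'\<close> in row \<open>i\<close>, and the right side only the arc of \<open>\<nu>\<close>
  in column \<open>j\<close>. An arc of \<open>\<nu>\<close> that is missing from \<open>\<nu>'\<close> therefore produces a longer missing arc,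
  so the induction runs from long arcs to short ones.
\<close>

lemma arc_fun_orbit_subset:
  fixes \<nu> \<nu>' :: "(nat \<times> nat \<times> 'a::{field,finite}) set"
  assumes \<nu>: "fq_set_partition n \<nu>" and \<nu>': "fq_set_partition n \<nu>'"
    and orb: "arc_fun n \<nu>' \<in> dual_double_orbit n (arc_fun n \<nu>)"
  shows "\<nu> \<subseteq> \<nu>'"
proof -
  obtain g h where g: "g \<in> carrier (UT n)" and h: "h \<in> carrier (UT n)"
    and e: "coeff_fun n (arc_label \<nu>') = translate n g h (coeff_fun n (arc_label \<nu>))"
    using orb unfolding dual_double_orbit_eq arc_fun_eq_coeff_fun[OF \<nu>] arc_fun_eq_coeff_fun[OF \<nu>'] by auto
  obtain h' where h': "h' \<in> carrier (UT n)" "h' * h = 1\<^sub>m n" using UT_inverse h by metis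
  have "translate n (1\<^sub>m n) h' (coeff_fun n (arc_label \<nu>')) = translate n g (1\<^sub>m n) (coeff_fun n (arc_label \<nu>))"
    unfolding e using translate_translate[OF g h one_UT h'(1)] h'(2) UT_carrier[OF g] by simp
  then have eq: "coeff_act n (1\<^sub>m n) h' (arc_label \<nu>') p = coeff_act n g (1\<^sub>m n) (arc_label \<nu>) p"
    if "p \<in> positions n" for p
    using that by (simp add: translate_coeff_fun one_UT g h'(1) coeff_fun_eq_iff)
  have "(i, j, a) \<in> \<nu>'" if "(i, j, a) \<in> \<nu>" for i j a
    using that
  proof (induction "n - (j - i)" arbitrary: i j a rule: less_induct)
    case less
    note ij = fq_set_partitionD[OF \<nu> less.prems]
    have "coeff_act n (1\<^sub>m n) h' (arc_label \<nu>') (i, j) = a"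
      using eq[OF ij(4)] coeff_act_col_arc[OF \<nu> g less.prems] by simp
    then obtain l b where b: "(i, l, b) \<in> \<nu>'" "j \<le> l"
      using coeff_act_row_nonzero[OF \<nu>' h'(1) ij(4)] ij(3) by metis
    note il = fq_set_partitionD[OF \<nu>' b(1)]
    have bb: "coeff_act n g (1\<^sub>m n) (arc_label \<nu>) (i, l) = b"
      using eq[OF il(4)] coeff_act_row_arc[OF \<nu>' h'(1) b(1)] by simp
    show ?case
    proof (cases "l = j")
      case True
      then have "a = b" using bb coeff_act_col_arc[OF \<nu> g less.prems] by simp
      then show ?thesis using b True by simp
    next
      case False
      \<comment> \<open>This arc of \<open>\<nu>\<close> is longer than the given one, so by
        induction it lies in \<open>\<nu>'\<close>. Uniqueness in column \<open>l\<close> of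
        \<open>\<nu>'\<close> gives \<open>k = i\<close>, and then row \<open>i\<close> of
        \<open>\<nu>\<close> holds two arcs, which is absurd.\<close>
      obtain k c where c: "(k, l, c) \<in> \<nu>" "k \<le> i"
        using coeff_act_col_nonzero[OF \<nu> g il(4)] bb il(3) by metis
      have "n - (l - k) < n - (j - i)"
        using False b(2) c(2) ij il by linarith
      then have "(k, l, c) \<in> \<nu>'" using less.hyps c(1) by blast
      then have "k = i" using fq_set_partition_col[OF \<nu>' b(1)] by blast
      then show ?thesis using False fq_set_partition_row[OF \<nu> less.prems] c(1) by blast
    qed
  qed
  then show ?thesis by auto
qed

text \<open>A common functional puts each representative into the orbit of the other, so the arcs
  are included in both directions.\<close>

lemma arc_fun_orbits_disjoint:
  fixes \<nu> \<nu>' :: "(nat \<times> nat \<times> 'a::{field,finite}) set"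
  assumes \<nu>: "fq_set_partition n \<nu>" and \<nu>': "fq_set_partition n \<nu>'"
    and \<psi>: "\<psi> \<in> dual_double_orbit n (arc_fun n \<nu>)" "\<psi> \<in> dual_double_orbit n (arc_fun n \<nu>')"
  shows "\<nu> = \<nu>'"
proof
  have s: "arc_fun n \<nu> \<in> dual_double_orbit n \<psi>" "arc_fun n \<nu>' \<in> dual_double_orbit n \<psi>"
    using \<psi> orbit_sym unfolding arc_fun_eq_coeff_fun[OF \<nu>] arc_fun_eq_coeff_fun[OF \<nu>'] by auto
  show "\<nu> \<subseteq> \<nu>'" using arc_fun_orbit_subset[OF \<nu> \<nu>'] orbit_trans[OF \<psi>(1) s(2)] by blast
  show "\<nu>' \<subseteq> \<nu>" using arc_fun_orbit_subset[OF \<nu>' \<nu>] orbit_trans[OF \<psi>(2) s(1)] by blast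
qed

section \<open>Every functional lies in the orbit of a set partition\<close>

text \<open>Through \<open>coeff_act\<close> this adds \<open>c i\<close> times row \<open>r\<close>
  to every row \<open>i\<close> below it at once; \<open>col_shear\<close> adds \<open>d j\<close>
  times column \<open>l\<close> to every column \<open>j\<close> to its left.\<close>

definition row_shear :: "nat \<Rightarrow> nat \<Rightarrow> (nat \<Rightarrow> 'a::field) \<Rightarrow> 'a mat" where
  "row_shear n r c = mat n n (\<lambda>(i, j). if i = j then 1 else if i = r \<and> r < j then c j else 0)"

definition col_shear :: "nat \<Rightarrow> nat \<Rightarrow> (nat \<Rightarrow> 'a::field) \<Rightarrow> 'a mat" where
  "col_shear n l d = mat n n (\<lambda>(i, j). if i = j then 1 else if j = l \<and> i < l then d i else 0)"

lemma row_shear_UT: "row_shear n r c \<in> carrier (UT n)"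
  by (auto simp: UT_iff row_shear_def)

lemma col_shear_UT: "col_shear n l d \<in> carrier (UT n)"
  by (auto simp: UT_iff col_shear_def)

lemma coeff_act_row_shear:
  assumes "(i, j) \<in> positions n"
  shows "coeff_act n (row_shear n r c) (1\<^sub>m n) m (i, j) = m (i, j) + (if r < i then c i * m (r, j) else 0)"
proof -
  have "(\<Sum>k<j. m (k, j) * row_shear n r c $$ (k, i))
      = (\<Sum>k<j. (if k = i then m (i, j) else 0) + (if k = r then if r < i then c i * m (r, j) else 0 else 0))"
    using assms by (intro sum.cong) (auto simp: row_shear_def)
  also have "\<dots> = m (i, j) + (if r < i then c i * m (r, j) else 0)"
    using assms by (auto simp: sum.distrib)
  finally show ?thesis using assms by (simp add: coeff_act_one_right)
qed

lemma coeff_act_col_shear: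
  assumes "(i, j) \<in> positions n" "l < n"
  shows "coeff_act n (1\<^sub>m n) (col_shear n l d) m (i, j) = m (i, j) + (if j < l then d j * m (i, l) else 0)"
proof -
  have "(\<Sum>k\<in>{i<..<n}. m (i, k) * col_shear n l d $$ (j, k))
      = (\<Sum>k\<in>{i<..<n}. (if k = j then m (i, j) else 0) + (if k = l then if j < l then d j * m (i, l) else 0 else 0))"
    using assms by (intro sum.cong) (auto simp: col_shear_def)
  also have "\<dots> = m (i, j) + (if j < l then d j * m (i, l) else 0)"
    using assms by (auto simp: sum.distrib)
  finally show ?thesis using assms by (simp add: coeff_act_one_left)
qed

definition isolated :: "nat \<Rightarrow> (nat \<times> nat \<Rightarrow> 'a::zero) \<Rightarrow> nat \<Rightarrow> nat \<Rightarrow> bool" where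
  "isolated n m i j \<longleftrightarrow> (\<forall>l. (i, l) \<in> positions n \<and> l \<noteq> j \<longrightarrow> m (i, l) = 0) \<and>
     (\<forall>k. (k, j) \<in> positions n \<and> k \<noteq> i \<longrightarrow> m (k, j) = 0)"

text \<open>Isolation refers to the whole array: the column of a finished entry must vanish in the
  untreated rows too, which keeps it isolated in later rounds.\<close>

definition reduced_rows :: "nat \<Rightarrow> nat \<Rightarrow> (nat \<times> nat \<Rightarrow> 'a::zero) \<Rightarrow> bool" where
  "reduced_rows n r m \<longleftrightarrow>
     (\<forall>i j. (i, j) \<in> positions n \<and> i < r \<and> m (i, j) \<noteq> 0 \<longrightarrow> isolated n m i j)"

text \<open>The pivot is the last nonzero entry of row \<open>r\<close>, because the two actions move coefficients only to
  the left and downwards.\<close>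

lemma reduce_row:
  fixes m :: "nat \<times> nat \<Rightarrow> 'a::{field,finite}"
  assumes red: "reduced_rows n r m"
  obtains m' where "coeff_fun n m' \<in> dual_double_orbit n (coeff_fun n m)" "reduced_rows n (Suc r) m'"
proof (cases "\<exists>l. (r, l) \<in> positions n \<and> m (r, l) \<noteq> 0")
  case False
  then have "reduced_rows n (Suc r) m"
    using red unfolding reduced_rows_def by (metis less_antisym)
  then show ?thesis using that orbit_refl by blast
next
  case True
  let ?S = "{l. (r, l) \<in> positions n \<and> m (r, l) \<noteq> 0}"
  define l where "l = Max ?S"
  have fin: "finite ?S" by (rule finite_subset[of _ "{..<n}"]) auto
  have "l \<in> ?S" unfolding l_def using fin True by (intro Max_in) auto
  then have l: "r < l" "l < n" "m (r, l) \<noteq> 0" by auto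
  have right: "m (r, j) = 0" if "l < j" "j < n" for j
  proof (rule ccontr)
    assume "m (r, j) \<noteq> 0"
    then have "j \<in> ?S" using that l by simp
    then have "j \<le> l" unfolding l_def by (rule Max_ge[OF fin])
    then show False using that by simp
  qed
  have iso: "isolated n m i j" if "i < r" "m (i, j) \<noteq> 0" "i < j" "j < n" for i j
    using red that unfolding reduced_rows_def by simp
  \<comment> \<open>A nonzero entry there would be isolated, which the pivot in the same column
    prevents.\<close>
  have above: "m (i, l) = 0" if "i < r" for i
  proof (rule ccontr)
    assume "m (i, l) \<noteq> 0"
    then have "isolated n m i l" using iso that l by simp
    then show False using that l by (simp add: isolated_def)
  qed
  \<comment> \<open>Chosen so that adding \<open>d j\<close> times the pivot cancels
    \<open>m (r, j)\<close>.\<close>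
  define d where "d j = - m (r, j) / m (r, l)" for j
  define m1 where "m1 = coeff_act n (1\<^sub>m n) (col_shear n l d) m"
  have m1: "m1 (i, j) = m (i, j) + (if j < l then d j * m (i, l) else 0)" if "i < j" "j < n" for i j
    using that l by (simp add: m1_def coeff_act_col_shear)
  have m1r: "m1 (r, j) = (if j = l then m (r, l) else 0)" if "r < j" "j < n" for j
    using that l right[of j] by (auto simp: m1 d_def)
  \<comment> \<open>Finished rows survive because column \<open>l\<close> vanishes in them.\<close>
  have m1t: "m1 (i, j) = m (i, j)" if "i < r" "i < j" "j < n" for i j
    using that above by (simp add: m1)
  \<comment> \<open>Chosen to clear column \<open>l\<close> below the pivot.\<close>
  define c where "c i = - m1 (i, l) / m1 (r, l)" for i
  define m2 where "m2 = coeff_act n (row_shear n r c) (1\<^sub>m n) m1"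
  have m2: "m2 (i, j) = m1 (i, j) + (if r < i then c i * m1 (r, j) else 0)" if "i < j" "j < n" for i j
    using that by (simp add: m2_def coeff_act_row_shear)
  have m2t: "m2 (i, j) = m (i, j)" if "i < r" "i < j" "j < n" for i j
    using that by (simp add: m2 m1t)
  have m2r: "m2 (r, j) = (if j = l then m (r, l) else 0)" if "r < j" "j < n" for j
    using that by (simp add: m2 m1r)
  have m2l: "m2 (i, l) = 0" if "i \<noteq> r" "i < l" for i
    using that l above[of i] by (cases "i < r") (auto simp: m2t m2 m1r c_def)
  \<comment> \<open>By now row \<open>r\<close> is nonzero only in column \<open>l\<close>, so the
    row operation alters no other column.\<close>
  have m2b: "m2 (i, j) = m (i, j) + (if j < l then d j * m (i, l) else 0)"
    if "r < i" "j \<noteq> l" "i < j" "j < n" for i j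
    using that by (simp add: m2 m1r) (simp add: m1)
  have "isolated n m2 i j" if ij: "i < j" "j < n" "i < Suc r" and nz: "m2 (i, j) \<noteq> 0" for i j
  proof (cases "i = r")
    case True
    then have "j = l" using m2r[of j] ij nz by (simp split: if_splits)
    then show ?thesis using True m2r m2l by (auto simp: isolated_def)
  next
    case False
    then have ir: "i < r" using ij by simp
    have mnz: "m (i, j) \<noteq> 0" using nz m2t ir ij by simp
    have iso_row: "m (i, j') = 0" if "i < j'" "j' < n" "j' \<noteq> j" for j'
      using iso[OF ir mnz ij(1,2)] that by (simp add: isolated_def)
    have iso_col: "m (k, j) = 0" if "k < j" "k \<noteq> i" for k
      using iso[OF ir mnz ij(1,2)] that ij by (simp add: isolated_def)
    have jl: "j \<noteq> l" using mnz above[OF ir] by auto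
    have "m2 (k, j) = 0" if k: "k < j" "k \<noteq> i" for k
    proof -
      consider "k < r" | "k = r" | "r < k" by linarith
      then show ?thesis
      proof cases
        case 1
        then show ?thesis using k ij by (simp add: m2t iso_col)
      next
        case 2
        then show ?thesis using k ij jl by (simp add: m2r)
      next
        case 3
        \<comment> \<open>The only nonzero entry of column \<open>j\<close> is in row
          \<open>i\<close>. In particular \<open>m (r, j) = 0\<close>, hence \<open>d j = 0\<close>,
          and the column operation leaves column \<open>j\<close> alone.\<close>
        have "m (k, j) = 0" "m (r, j) = 0" using k 3 ir by (simp_all add: iso_col)
        then show ?thesis using 3 k ij jl by (simp add: m2b d_def)
      qed
    qed
    moreover have "m2 (i, j') = 0" if "i < j'" "j' < n" "j' \<noteq> j" for j'
      using that ir by (simp add: m2t iso_row)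
    ultimately show ?thesis by (auto simp: isolated_def)
  qed
  then have "reduced_rows n (Suc r) m2" by (auto simp: reduced_rows_def)
  moreover have "coeff_fun n m1 \<in> dual_double_orbit n (coeff_fun n m)"
    unfolding m1_def translate_coeff_fun[OF one_UT col_shear_UT, symmetric]
    by (intro translate_in_orbit one_UT col_shear_UT)
  moreover have "coeff_fun n m2 \<in> dual_double_orbit n (coeff_fun n m1)"
    unfolding m2_def translate_coeff_fun[OF row_shear_UT one_UT, symmetric]
    by (intro translate_in_orbit one_UT row_shear_UT)
  ultimately show ?thesis using that orbit_trans by blast
qed

lemma reduce_rows:
  fixes m :: "nat \<times> nat \<Rightarrow> 'a::{field,finite}"
  shows "\<exists>m'. coeff_fun n m' \<in> dual_double_orbit n (coeff_fun n m) \<and> reduced_rows n r m'"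
proof (induction r)
  case 0
  have "reduced_rows n 0 m" by (simp add: reduced_rows_def)
  then show ?case using orbit_refl by blast
next
  case (Suc r)
  then obtain m1 where m1: "coeff_fun n m1 \<in> dual_double_orbit n (coeff_fun n m)" "reduced_rows n r m1" by blast
  obtain m2 where "coeff_fun n m2 \<in> dual_double_orbit n (coeff_fun n m1)" "reduced_rows n (Suc r) m2"
    using reduce_row[OF m1(2)] by blast
  then show ?case using orbit_trans[OF m1(1)] by blast
qed

text \<open>Once all \<open>n\<close> rows are reduced, every nonzero entry is alone in its row and
  column, so the support with its values is a set partition.\<close>

lemma coeff_fun_in_arc_fun_orbit:
  fixes m :: "nat \<times> nat \<Rightarrow> 'a::{field,finite}"
  obtains \<nu> where "fq_set_partition n \<nu>" "coeff_fun n m \<in> dual_double_orbit n (arc_fun n \<nu>)"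
proof -
  obtain m' where m': "coeff_fun n m' \<in> dual_double_orbit n (coeff_fun n m)" "reduced_rows n n m'"
    using reduce_rows by blast
  define \<nu> where "\<nu> = {(i, j, a). (i, j) \<in> positions n \<and> a = m' (i, j) \<and> a \<noteq> 0}"
  have iso: "m' (i, k) = 0 \<and> m' (k, j) = 0" if "m' (i, j) \<noteq> 0" "i < k" "k < j" "j < n" for i j k
  proof -
    have "isolated n m' i j" using m'(2) that unfolding reduced_rows_def by auto
    then show ?thesis using that unfolding isolated_def by auto
  qed
  have p: "fq_set_partition n \<nu>"
    unfolding fq_set_partition_def
  proof (intro conjI allI impI)
    fix i j k a b assume "(i, j, a) \<in> \<nu> \<and> i < k \<and> k < j"
    then show "(i, k, b) \<notin> \<nu>" "(k, j, b) \<notin> \<nu>"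
      using iso[of i j k] by (auto simp: \<nu>_def)
  qed (auto simp: \<nu>_def)
  have "arc_label \<nu> q = m' q" if "q \<in> positions n" for q
  proof (cases q)
    case (Pair i j)
    show ?thesis
    proof (cases "m' q = 0")
      case True
      then have "\<not> (\<exists>a. (i, j, a) \<in> \<nu>)" using Pair by (auto simp: \<nu>_def)
      then show ?thesis using True Pair by (simp add: arc_label_def)
    next
      case False
      then have "(i, j, m' q) \<in> \<nu>" using Pair that by (auto simp: \<nu>_def)
      then show ?thesis using arc_label_eq[OF p] Pair by simp
    qed
  qed
  then have "arc_fun n \<nu> = coeff_fun n m'" by (simp add: arc_fun_eq_coeff_fun[OF p] coeff_fun_eq_iff)
  then show ?thesis using that[OF p] orbit_sym[OF m'(1)] by simp
qed

section \<open>Corners\<close>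

lemma fq_set_partition_subset: "fq_set_partition n \<nu> \<Longrightarrow> \<nu>' \<subseteq> \<nu> \<Longrightarrow> fq_set_partition n \<nu>'"
  unfolding fq_set_partition_def by blast

lemma big_subset: "big \<nu> \<subseteq> \<nu>" by (auto simp: big_def)

lemma sml_subset: "sml \<nu> \<subseteq> \<nu>" by (auto simp: sml_def)

lemma nonnesting_big: "nonnesting (big \<nu>)"
  unfolding nonnesting_def big_def by fastforce

text \<open>Arcs sharing a left or a right endpoint coincide. This turns weak containment into the
  strict one used by \<open>big\<close>, \<open>sml\<close> and \<open>nonnesting\<close>.\<close>

lemma strictly_nested:
  assumes "fq_set_partition n \<nu>" "(i, j, a) \<in> \<nu>" "(k, l, b) \<in> \<nu>" "i \<le> k" "l \<le> j"
  shows "i = k \<and> j = l \<and> a = b \<or> i < k \<and> l < j"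
proof (cases "i = k \<or> j = l")
  case True
  then show ?thesis
    using fq_set_partition_row[OF assms(1,2)] fq_set_partition_col[OF assms(1,2)] assms(3) by blast
qed (use assms in auto)

lemma nonnesting_antichain:
  assumes \<eta>: "fq_set_partition n \<eta>" "nonnesting \<eta>"
    and a: "(i, j, a) \<in> \<eta>" "(k, l, b) \<in> \<eta>" "i \<le> k" "l \<le> j"
  shows "i = k \<and> j = l \<and> a = b"
  using strictly_nested[OF \<eta>(1) a] fq_set_partitionD(1)[OF \<eta>(1) a(2)] \<eta>(2) a(1,2)
  unfolding nonnesting_def by blast

text \<open>Passing to an enclosing arc increases the length, which is bounded by \<open>n\<close>,
  so the climb ends at a maximal arc.\<close>

lemma arc_in_big:
  assumes \<nu>: "fq_set_partition n \<nu>" and "(k, l, b) \<in> \<nu>"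
  shows "\<exists>i j a. (i, j, a) \<in> big \<nu> \<and> i \<le> k \<and> l \<le> j"
  using assms(2)
proof (induction "n - (l - k)" arbitrary: k l b rule: less_induct)
  case less
  note kl = fq_set_partitionD[OF \<nu> less.prems]
  show ?case
  proof (cases "(k, l, b) \<in> big \<nu>")
    case False
    then obtain i j a where ij: "(i, j, a) \<in> \<nu>" "i < k" "l < j"
      using less.prems by (auto simp: big_def)
    have "n - (j - i) < n - (l - k)" using ij kl fq_set_partitionD(2)[OF \<nu> ij(1)] by linarith
    then obtain i' j' a' where "(i', j', a') \<in> big \<nu>" "i' \<le> i" "j \<le> j'"
      using less.hyps ij(1) by blast
    then show ?thesis using ij by (intro exI[of _ i'] exI[of _ j'] exI[of _ a']) simp
  qed auto
qed

text \<open>The dual descent through shorter and shorter arcs.\<close>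

lemma arc_contains_sml:
  assumes \<nu>: "fq_set_partition n \<nu>" and "(k, l, b) \<in> \<nu>"
  shows "\<exists>i j a. (i, j, a) \<in> sml \<nu> \<and> k \<le> i \<and> j \<le> l"
  using assms(2)
proof (induction "l - k" arbitrary: k l b rule: less_induct)
  case less
  note kl = fq_set_partitionD[OF \<nu> less.prems]
  show ?case
  proof (cases "(k, l, b) \<in> sml \<nu>")
    case False
    then obtain i j a where ij: "(i, j, a) \<in> \<nu>" "k < i" "i < j" "j < l"
      using less.prems by (auto simp: sml_def)
    have "j - i < l - k" using ij by linarith
    then obtain i' j' a' where "(i', j', a') \<in> sml \<nu>" "i \<le> i'" "j' \<le> j"
      using less.hyps ij(1) by blast
    then show ?thesis using ij by (intro exI[of _ i'] exI[of _ j'] exI[of _ a']) simp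
  qed auto
qed

text \<open>Positions sharing one endpoint with an arc count as inside, since a coefficient can also
  move along its own row or column.\<close>

definition strictly_inside :: "(nat \<times> nat \<times> 'a) set \<Rightarrow> nat \<times> nat \<Rightarrow> bool" where
  "strictly_inside \<eta> p \<longleftrightarrow>
     (\<exists>i j a. (i, j, a) \<in> \<eta> \<and> i \<le> fst p \<and> snd p \<le> j \<and> (i, j) \<noteq> p)"

text \<open>For a nonnesting \<open>\<eta>\<close>, a coefficient array has its outermost nonzero entries exactly at the arcs of
  \<open>\<eta>\<close>, with the labels as values, iff its entry at every position \<open>p\<close> lies in \<open>corner_range \<eta> p\<close>.\<close>

definition corner_range :: "(nat \<times> nat \<times> 'a::field) set \<Rightarrow> nat \<times> nat \<Rightarrow> 'a set" where
  "corner_range \<eta> p =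
     (if arc_label \<eta> p \<noteq> 0 then {arc_label \<eta> p} else if strictly_inside \<eta> p then UNIV else {0})"

lemma corner_range_arc:
  "fq_set_partition n \<eta> \<Longrightarrow> (i, j, a) \<in> \<eta> \<Longrightarrow> corner_range \<eta> (i, j) = {a}"
  using fq_set_partitionD(3)[of n \<eta> i j a] by (simp add: corner_range_def arc_label_eq)

lemma corner_range_nonzero:
  assumes \<eta>: "fq_set_partition n \<eta>" and c: "c \<in> corner_range \<eta> (k, l)" "c \<noteq> 0"
  shows "\<exists>i j a. (i, j, a) \<in> \<eta> \<and> i \<le> k \<and> l \<le> j"
proof (cases "arc_label \<eta> (k, l) = 0")
  case True
  then have "strictly_inside \<eta> (k, l)" using c by (auto simp: corner_range_def split: if_splits)
  then show ?thesis by (auto simp: strictly_inside_def)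
next
  case False
  then show ?thesis using arc_label_nonzero_iff[OF \<eta>] by blast
qed

text \<open>An arc of \<open>\<eta>\<close> is a nonzero entry, so it lies under an arc of
  \<open>\<eta>'\<close>, which is again a nonzero entry and lies under an arc of
  \<open>\<eta>\<close>. The antichain property collapses this chain, and both labels equal the
  value of \<open>m\<close>.\<close>

lemma corner_range_subset:
  assumes \<eta>: "fq_set_partition n \<eta>" "nonnesting \<eta>" and \<eta>': "fq_set_partition n \<eta>'"
    and m: "\<And>p. p \<in> positions n \<Longrightarrow> m p \<in> corner_range \<eta> p"
    and m': "\<And>p. p \<in> positions n \<Longrightarrow> m p \<in> corner_range \<eta>' p"
  shows "\<eta> \<subseteq> \<eta>'"
proof
  fix t assume t: "t \<in> \<eta>"
  obtain i j a where [simp]: "t = (i, j, a)" by (cases t)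
  have a: "(i, j, a) \<in> \<eta>" using t by simp
  note ij = fq_set_partitionD[OF \<eta>(1) a]
  have ma: "m (i, j) = a" using m[OF ij(4)] corner_range_arc[OF \<eta>(1) a] by simp
  then obtain k l b where b: "(k, l, b) \<in> \<eta>'" "k \<le> i" "j \<le> l"
    using corner_range_nonzero[OF \<eta>' m'[OF ij(4)]] ij(3) by blast
  note kl = fq_set_partitionD[OF \<eta>' b(1)]
  have mb: "m (k, l) = b" using m'[OF kl(4)] corner_range_arc[OF \<eta>' b(1)] by simp
  then obtain i' j' a' where a': "(i', j', a') \<in> \<eta>" "i' \<le> k" "l \<le> j'"
    using corner_range_nonzero[OF \<eta>(1) m[OF kl(4)]] kl(3) by blast
  have "i' = i \<and> j' = j \<and> a' = a"
    using a'(2,3) b(2,3) by (intro nonnesting_antichain[OF \<eta> a'(1) a]) simp_all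
  then have "k = i" "l = j" using a'(2,3) b(2,3) by simp_all
  then show "t \<in> \<eta>'" using b(1) ma mb by simp
qed

text \<open>An entry collects only from arcs weakly enclosing its position. On an arc of
  \<open>big \<nu>\<close> that arc alone contributes, with diagonal factors 1; outside all of them
  nothing does.\<close>

lemma coeff_act_in_corner_range:
  assumes \<nu>: "fq_set_partition n \<nu>" and g: "g \<in> carrier (UT n)" and h: "h \<in> carrier (UT n)"
    and p: "p \<in> positions n"
  shows "coeff_act n g h (arc_label \<nu>) p \<in> corner_range (big \<nu>) p"
proof -
  obtain i j where [simp]: "p = (i, j)" by (cases p)
  have ij: "i < j" "j < n" using p by simp_all
  let ?t = "\<lambda>(k, l). arc_label \<nu> (k, l) * g $$ (k, i) * h $$ (j, l)"
  note big = fq_set_partition_subset[OF \<nu> big_subset]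
  have supp: "(k, l, arc_label \<nu> (k, l)) \<in> \<nu> \<and> k \<le> i \<and> j \<le> l" if "(k, l) \<in> positions n" "?t (k, l) \<noteq> 0" for k l
  proof -
    have "arc_label \<nu> (k, l) \<noteq> 0" "g $$ (k, i) \<noteq> 0" "h $$ (j, l) \<noteq> 0" using that(2) by auto
    moreover have "k < n" "l < n" using that(1) by simp_all
    ultimately show ?thesis
      using arc_label_nonzero_iff[OF \<nu>, of k l] UT_entry_nonzero[OF g, of k i]
        UT_entry_nonzero[OF h, of j l] ij by simp
  qed
  show ?thesis
  proof (cases "arc_label (big \<nu>) p = 0")
    case False
    then obtain a where a: "(i, j, a) \<in> big \<nu>" using arc_label_nonzero_iff[OF big] by auto
    have a': "(i, j, a) \<in> \<nu>" using a big_subset by blast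
    have "?t q = (if q = (i, j) then a else 0)" if q: "q \<in> positions n" for q
    proof (cases "?t q = 0")
      case True
      have "?t (i, j) \<noteq> 0"
        using ij arc_label_eq[OF \<nu> a'] fq_set_partitionD(3)[OF \<nu> a'] by (simp add: UT_entry[OF g] UT_entry[OF h])
      then show ?thesis using True by auto
    next
      case False
      obtain k l where [simp]: "q = (k, l)" by (cases q)
      have t: "(k, l, arc_label \<nu> (k, l)) \<in> \<nu>" "k \<le> i" "j \<le> l" using supp[of k l] q False by auto
      \<comment> \<open>Maximality: an arc of \<open>\<nu>\<close> around an arc of
        \<open>big \<nu>\<close> is that arc itself.\<close>
      have "\<not> (k < i \<and> j < l)" using t(1) a ij(1) unfolding big_def by auto
      then have "k = i \<and> l = j" using strictly_nested[OF \<nu> t(1) a' t(2,3)] by blast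
      then show ?thesis using ij arc_label_eq[OF \<nu> a'] by (simp add: UT_entry[OF g] UT_entry[OF h])
    qed
    then have "sum ?t (positions n) = (\<Sum>q\<in>positions n. if q = (i, j) then a else 0)"
      by (rule sum.cong[OF refl])
    then have "coeff_act n g h (arc_label \<nu>) p = a" using p by (simp add: coeff_act_def)
    then show ?thesis using corner_range_arc[OF big a] by simp
  next
    case True
    show ?thesis
    proof (cases "strictly_inside (big \<nu>) p")
      case False
      have "?t q = 0" if q: "q \<in> positions n" for q
      proof (rule ccontr)
        assume nz: "?t q \<noteq> 0"
        obtain k l where [simp]: "q = (k, l)" by (cases q)
        have t: "(k, l, arc_label \<nu> (k, l)) \<in> \<nu>" "k \<le> i" "j \<le> l" using supp[of k l] q nz by auto
        \<comment> \<open>The contributing arc extends to a maximal one, which differs from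
          \<open>p\<close> because \<open>p\<close> carries no arc of
          \<open>big \<nu>\<close>.\<close>
        obtain k' l' b where b: "(k', l', b) \<in> big \<nu>" "k' \<le> k" "l \<le> l'"
          using arc_in_big[OF \<nu> t(1)] by blast
        have "(k', l') \<noteq> (i, j)"
          using True arc_label_eq[OF big b(1)] fq_set_partitionD(3)[OF big b(1)] by auto
        then have "strictly_inside (big \<nu>) p"
          using b t(2,3) unfolding strictly_inside_def
          by (intro exI[of _ k'] exI[of _ l'] exI[of _ b]) simp
        then show False using False by simp
      qed
      then have "sum ?t (positions n) = 0" by (intro sum.neutral) simp
      then have "coeff_act n g h (arc_label \<nu>) p = 0" by (simp add: coeff_act_def)
      then show ?thesis using True False by (simp add: corner_range_def)
    qed (use True in \<open>simp add: corner_range_def\<close>)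
  qed
qed

text \<open>The inclusion from right to left uses that every functional lies in the orbit of some
  \<open>\<nu>\<close>; comparing corners then identifies \<open>big \<nu>\<close> with
  \<open>\<eta>\<close>. \<open>PiE\<close> selects one extensional array per functional.\<close>

lemma Union_orbits_eq:
  fixes \<eta> :: "(nat \<times> nat \<times> 'a::{field,finite}) set"
  assumes \<eta>: "fq_set_partition n \<eta>" "nonnesting \<eta>"
  shows "(\<Union>\<nu>\<in>{\<nu>. fq_set_partition n \<nu> \<and> big \<nu> = \<eta>}. dual_double_orbit n (arc_fun n \<nu>)) =
    coeff_fun n ` PiE (positions n) (corner_range \<eta>)" (is "?L = ?R")
proof (intro equalityI subsetI)
  fix \<psi> assume "\<psi> \<in> ?L"
  then obtain \<nu> g h where \<nu>: "fq_set_partition n \<nu>" "big \<nu> = \<eta>"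
    and gh: "g \<in> carrier (UT n)" "h \<in> carrier (UT n)" "\<psi> = translate n g h (arc_fun n \<nu>)"
    unfolding dual_double_orbit_eq by blast
  let ?m = "restrict (coeff_act n g h (arc_label \<nu>)) (positions n)"
  have "\<psi> = coeff_fun n ?m"
    unfolding gh(3) arc_fun_eq_coeff_fun[OF \<nu>(1)] translate_coeff_fun[OF gh(1,2)] by (simp add: coeff_fun_eq_iff)
  moreover have "?m \<in> PiE (positions n) (corner_range \<eta>)"
    using coeff_act_in_corner_range[OF \<nu>(1) gh(1,2)] \<nu>(2) by simp
  ultimately show "\<psi> \<in> ?R" by blast
next
  fix \<psi> assume "\<psi> \<in> ?R"
  then obtain m where m: "\<psi> = coeff_fun n m" "m \<in> PiE (positions n) (corner_range \<eta>)" by blast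
  obtain \<nu> where \<nu>: "fq_set_partition n \<nu>" "coeff_fun n m \<in> dual_double_orbit n (arc_fun n \<nu>)"
    using coeff_fun_in_arc_fun_orbit by blast
  obtain g h where gh: "g \<in> carrier (UT n)" "h \<in> carrier (UT n)"
      "coeff_fun n m = translate n g h (arc_fun n \<nu>)"
    using \<nu>(2) unfolding dual_double_orbit_eq by blast
  have m_act: "m p = coeff_act n g h (arc_label \<nu>) p" if "p \<in> positions n" for p
    using gh(3) that unfolding arc_fun_eq_coeff_fun[OF \<nu>(1)] translate_coeff_fun[OF gh(1,2)]
    by (simp add: coeff_fun_eq_iff)
  have r: "m p \<in> corner_range \<eta> p" "m p \<in> corner_range (big \<nu>) p" if "p \<in> positions n" for p
    using PiE_mem[OF m(2) that] coeff_act_in_corner_range[OF \<nu>(1) gh(1,2) that] m_act[OF that] by simp_all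
  note big = fq_set_partition_subset[OF \<nu>(1) big_subset] nonnesting_big[of \<nu>]
  have "big \<nu> = \<eta>"
    using corner_range_subset[OF \<eta> big(1) r] corner_range_subset[OF big \<eta>(1) r(2,1)] by blast
  then show "\<psi> \<in> ?L" using \<nu> m(1) by blast
qed

text \<open>Multiplying a matrix by \<open>u\<close> and \<open>v\<close> spreads entries outwards,
  so the roles are reversed: an entry collects from arcs weakly inside its position, and minimal
  arcs keep their labels.\<close>

lemma superclass_corners:
  fixes g :: "'a::{field,finite} mat"
  assumes g: "g \<in> K_nonnest n \<nu>"
  shows "ut_part n g \<in> ut n"
    and "(i, j, b) \<in> \<nu> \<Longrightarrow> ut_part n g $$ (i, j) = b"
    and "(i, j) \<in> positions n \<Longrightarrow> ut_part n g $$ (i, j) \<noteq> 0 \<Longrightarrow>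
      \<exists>k l b. (k, l, b) \<in> \<nu> \<and> i \<le> k \<and> l \<le> j"
proof -
  obtain \<mu> where \<mu>: "fq_set_partition n \<mu>" "sml \<mu> = \<nu>" and "g \<in> K n \<mu>"
    using g by (auto simp: K_nonnest_def)
  then obtain u v where u: "u \<in> carrier (UT n)" and v: "v \<in> carrier (UT n)"
    and x: "ut_part n g = u * arc_mat n \<mu> * v"
    by (auto simp: K_def double_orbit_def)
  show "ut_part n g \<in> ut n"
    unfolding x using u v arc_mat_ut[OF \<mu>(1)] by (intro ut_mult_UT UT_mult_ut)
  let ?t = "\<lambda>i j (k, l). u $$ (i, k) * arc_label \<mu> (k, l) * v $$ (l, j)"
  have entry: "ut_part n g $$ (i, j) = sum (?t i j) (positions n)" if "(i, j) \<in> positions n" for i j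
  proof -
    have "ut_part n g $$ (i, j)
        = (\<Sum>(k, l)\<in>positions n. u $$ (i, k) * arc_mat n \<mu> $$ (k, l) * v $$ (l, j))"
      unfolding x using that
      by (intro mult_mult_entry UT_carrier[OF u] UT_carrier[OF v] arc_mat_ut[OF \<mu>(1)]) simp_all
    also have "\<dots> = sum (?t i j) (positions n)"
      by (intro sum.cong) (auto simp: arc_mat_entry[OF \<mu>(1)])
    finally show ?thesis .
  qed
  have supp: "(k, l, arc_label \<mu> (k, l)) \<in> \<mu> \<and> i \<le> k \<and> l \<le> j"
    if "(k, l) \<in> positions n" "(i, j) \<in> positions n" "?t i j (k, l) \<noteq> 0" for i j k l
  proof -
    have "arc_label \<mu> (k, l) \<noteq> 0" "u $$ (i, k) \<noteq> 0" "v $$ (l, j) \<noteq> 0" using that(3) by auto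
    moreover have "i < n" "l < n" using that(1,2) by simp_all
    ultimately show ?thesis
      using arc_label_nonzero_iff[OF \<mu>(1), of k l] UT_entry_nonzero[OF u, of i k]
        UT_entry_nonzero[OF v, of l j] by simp
  qed
  {
    assume b: "(i, j, b) \<in> \<nu>"
    then have b': "(i, j, b) \<in> \<mu>" using \<mu>(2) sml_subset by blast
    note ij = fq_set_partitionD[OF \<mu>(1) b']
    have "?t i j q = (if q = (i, j) then b else 0)" if q: "q \<in> positions n" for q
    proof (cases "?t i j q = 0")
      case True
      have "?t i j (i, j) \<noteq> 0"
        using ij arc_label_eq[OF \<mu>(1) b'] by (simp add: UT_entry[OF u] UT_entry[OF v])
      then show ?thesis using True by auto
    next
      case False
      obtain k l where [simp]: "q = (k, l)" by (cases q)
      have t: "(k, l, arc_label \<mu> (k, l)) \<in> \<mu>" "i \<le> k" "l \<le> j" using supp[of k l i j] q False ij by auto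
      have "k < l" using q by simp
      \<comment> \<open>No arc of \<open>\<mu>\<close> lies strictly inside an arc of
        \<open>sml \<mu>\<close>.\<close>
      then have "\<not> (i < k \<and> l < j)" using t(1) b \<mu>(2) unfolding sml_def by auto
      then have "k = i \<and> l = j" using strictly_nested[OF \<mu>(1) b' t] by blast
      then show ?thesis using ij arc_label_eq[OF \<mu>(1) b'] by (simp add: UT_entry[OF u] UT_entry[OF v])
    qed
    then have "sum (?t i j) (positions n) = (\<Sum>q\<in>positions n. if q = (i, j) then b else 0)"
      by (rule sum.cong[OF refl])
    then show "ut_part n g $$ (i, j) = b" using entry[OF ij(4)] ij(4) by simp
  next
    assume ij: "(i, j) \<in> positions n" and nz: "ut_part n g $$ (i, j) \<noteq> 0"
    obtain q where q: "q \<in> positions n" "?t i j q \<noteq> 0"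
      using nz unfolding entry[OF ij] by (rule sum.not_neutral_contains_not_neutral)
    obtain k l where [simp]: "q = (k, l)" by (cases q)
    have t: "(k, l, arc_label \<mu> (k, l)) \<in> \<mu>" "i \<le> k" "l \<le> j" using supp[of k l i j] q ij by auto
    \<comment> \<open>The contributing arc of \<open>\<mu>\<close> may not be minimal; descending
      inside it reaches an arc of \<open>\<nu>\<close>.\<close>
    obtain k' l' b where "(k', l', b) \<in> \<nu>" "k \<le> k'" "l' \<le> l"
      using arc_contains_sml[OF \<mu>(1) t(1)] \<mu>(2) by blast
    then show "\<exists>k l b. (k, l, b) \<in> \<nu> \<and> i \<le> k \<and> l \<le> j"
      using t(2,3) by (intro exI[of _ k'] exI[of _ l'] exI[of _ b]) simp
  }
qed

section \<open>Factorisation of the character sum\<close>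

lemma hom_zero:
  fixes \<theta> :: "'a::field \<Rightarrow> complex"
  assumes "\<And>x y. \<theta> (x + y) = \<theta> x * \<theta> y" "\<And>x. \<theta> x \<noteq> 0"
  shows "\<theta> 0 = 1"
  using assms(1)[of 0 0] assms(2)[of 0] by simp

lemma hom_sum:
  fixes \<theta> :: "'a::field \<Rightarrow> complex"
  assumes "\<And>x y. \<theta> (x + y) = \<theta> x * \<theta> y" "\<And>x. \<theta> x \<noteq> 0"
  shows "\<theta> (sum f A) = (\<Prod>p\<in>A. \<theta> (f p))"
  by (induction A rule: infinite_finite_induct) (simp_all add: hom_zero[OF assms] assms(1))

text \<open>Shifting \<open>c\<close> by \<open>y / x\<close> permutes the field and multiplies the
  sum by \<open>\<theta> y\<close>, which is not 1.\<close>

lemma sum_additive_character: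
  fixes \<theta> :: "'a::{field,finite} \<Rightarrow> complex"
  assumes hom: "\<And>x y. \<theta> (x + y) = \<theta> x * \<theta> y" "\<exists>y. \<theta> y \<noteq> 1" and x: "x \<noteq> 0"
  shows "(\<Sum>c\<in>UNIV. \<theta> (c * x)) = 0"
proof -
  obtain y where y: "\<theta> y \<noteq> 1" using hom(2) by blast
  have "bij (\<lambda>c. c + y / x)" by (rule bij_betw_byWitness[where f' = "\<lambda>c. c - y / x"]) auto
  then have "(\<Sum>c\<in>UNIV. \<theta> (c * x)) = (\<Sum>c\<in>UNIV. \<theta> ((c + y / x) * x))"
    by (rule sum.reindex_bij_betw[symmetric])
  also have "\<dots> = (\<Sum>c\<in>UNIV. \<theta> (c * x) * \<theta> y)"
    using x by (simp add: distrib_right hom(1))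
  also have "\<dots> = (\<Sum>c\<in>UNIV. \<theta> (c * x)) * \<theta> y" by (rule sum_distrib_right[symmetric])
  finally show ?thesis using y by simp
qed

text \<open>Disjointness merges the double sum into one over a product set. There \<theta> turns the
  sum over positions into a product, and distributivity read backwards gives the
  factorisation.\<close>

lemma chi_nonnest_eq_prod:
  fixes \<theta> :: "'a::{field,finite} \<Rightarrow> complex"
  assumes hom: "\<And>x y. \<theta> (x + y) = \<theta> x * \<theta> y" "\<And>x. \<theta> x \<noteq> 0"
    and \<eta>: "fq_set_partition n \<eta>" "nonnesting \<eta>"
    and g: "ut_part n g \<in> ut n"
  shows "chi_nonnest n \<theta> \<eta> g =
    (\<Prod>p\<in>positions n. \<Sum>c\<in>corner_range \<eta> p. \<theta> (c * ut_part n g $$ p))"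
proof -
  let ?S = "{\<nu>. fq_set_partition n \<nu> \<and> big \<nu> = \<eta>}" and ?x = "ut_part n g"
  have fin: "finite ?S" by (rule finite_subset[OF _ finite_fq_set_partitions[of n]]) auto
  have inj: "inj_on (coeff_fun n) (PiE (positions n) (corner_range \<eta>))"
    by (intro inj_onI PiE_ext) (auto simp: coeff_fun_eq_iff)
  have "chi_nonnest n \<theta> \<eta> g = (\<Sum>\<mu>\<in>(\<Union>\<nu>\<in>?S. dual_double_orbit n (arc_fun n \<nu>)). \<theta> (\<mu> ?x))"
    unfolding chi_nonnest_def chi_def
  proof (rule sum.UNION_disjoint[symmetric, OF fin])
    show "\<forall>\<nu>\<in>?S. \<forall>\<nu>'\<in>?S. \<nu> \<noteq> \<nu>' \<longrightarrow>
        dual_double_orbit n (arc_fun n \<nu>) \<inter> dual_double_orbit n (arc_fun n \<nu>') = {}"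
      using arc_fun_orbits_disjoint by blast
  qed (simp add: finite_dual_double_orbit)
  also have "\<dots> = (\<Sum>m\<in>PiE (positions n) (corner_range \<eta>). \<theta> (coeff_fun n m ?x))"
    unfolding Union_orbits_eq[OF \<eta>] by (simp add: sum.reindex[OF inj])
  also have "\<dots> = (\<Sum>m\<in>PiE (positions n) (corner_range \<eta>). \<Prod>p\<in>positions n. \<theta> (m p * ?x $$ p))"
    using g by (simp add: coeff_fun_def hom_sum[OF hom])
  also have "\<dots> = (\<Prod>p\<in>positions n. \<Sum>c\<in>corner_range \<eta> p. \<theta> (c * ?x $$ p))"
    by (rule prod_sum_PiE[symmetric]) auto
  finally show ?thesis .
qed

section \<open>Evaluation on a superclass\<close>

theorem proposition5p3:
  fixes n :: nat
    and \<theta> :: "'a::{field,finite} \<Rightarrow> complex"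
    and \<eta> \<nu> :: "(nat \<times> nat \<times> 'a) set"
    and g :: "'a mat"
  assumes theta_hom: "\<And>x y. \<theta> (x + y) = \<theta> x * \<theta> y"
    and theta_nonzero: "\<And>x. \<theta> x \<noteq> 0"
    and theta_nontrivial: "\<exists>x. \<theta> x \<noteq> 1"
    and eta: "fq_set_partition n \<eta>" "nonnesting \<eta>"
    and nu: "fq_set_partition n \<nu>" "nonnesting \<nu>"
    and g: "g \<in> K_nonnest n \<nu>"
  shows "chi_nonnest n \<theta> \<eta> g =
    (if \<not> (\<exists>i j a k l b. (i, j, a) \<in> \<eta> \<and> (k, l, b) \<in> \<nu> \<and> (i, j) \<noteq> (k, l) \<and>
                i \<le> k \<and> k < l \<and> l \<le> j)
     then chi_nonnest n \<theta> \<eta> (1\<^sub>m n) *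
          (\<Prod>(i, j, a, b)\<in>{(i, j, a, b). (i, j, a) \<in> \<eta> \<and> (i, j, b) \<in> \<nu>}. \<theta> (a * b))
     else 0)"
proof -
  let ?x = "ut_part n g" and ?P = "positions n"
  note x = superclass_corners[OF g]
  note th0 = hom_zero[OF theta_hom theta_nonzero]
  let ?f = "\<lambda>x p. \<Sum>c\<in>corner_range \<eta> p. \<theta> (c * x $$ p)"
  have chi: "chi_nonnest n \<theta> \<eta> g = prod (?f ?x) ?P"
    by (rule chi_nonnest_eq_prod[OF theta_hom theta_nonzero eta x(1)])
  show ?thesis
  proof (cases "\<exists>i j a k l b. (i, j, a) \<in> \<eta> \<and> (k, l, b) \<in> \<nu> \<and> (i, j) \<noteq> (k, l) \<and>
                i \<le> k \<and> k < l \<and> l \<le> j")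
    case True
    then obtain i j a k l b where a: "(i, j, a) \<in> \<eta>" and b: "(k, l, b) \<in> \<nu>"
      and ijkl: "(i, j) \<noteq> (k, l)" "i \<le> k" "l \<le> j" by blast
    note kl = fq_set_partitionD[OF nu(1) b]
    have "strictly_inside \<eta> (k, l)" using a ijkl by (auto simp: strictly_inside_def)
    moreover have "arc_label \<eta> (k, l) = 0"
    proof (rule ccontr)
      assume "arc_label \<eta> (k, l) \<noteq> 0"
      then show False
        using nonnesting_antichain[OF eta a _ ijkl(2,3)] arc_label_nonzero_iff[OF eta(1)] ijkl(1) by blast
    qed
    \<comment> \<open>At this position the coefficient is free while the entry of \<open>?x\<close>
      is the nonzero label \<open>b\<close>.\<close>
    ultimately have "?f ?x (k, l) = 0"
      using sum_additive_character[OF theta_hom theta_nontrivial kl(3)]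
      by (simp add: corner_range_def x(2)[OF b])
    then have "prod (?f ?x) ?P = 0" using kl(4) by (intro prod_zero) auto
    then show ?thesis using True chi by simp
  next
    case False
    let ?A = "{(i, j, a, b). (i, j, a) \<in> \<eta> \<and> (i, j, b) \<in> \<nu>}"
    let ?h = "\<lambda>(i, j, a, b). (i, j)"
    let ?t = "\<lambda>p. \<theta> (arc_label \<eta> p * arc_label \<nu> p)"
    \<comment> \<open>At the identity all entries vanish, so each factor is the size of its
      range.\<close>
    have zero_ut: "ut_part n (1\<^sub>m n :: 'a mat) \<in> ut n" "\<And>p. p \<in> ?P \<Longrightarrow> ut_part n (1\<^sub>m n :: 'a mat) $$ p = 0"
      by (auto simp: ut_part_def ut_def positions_def)
    \<comment> \<open>Compare each kind of range with its size: a prescribed coefficient contributes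
      \<theta> of the product of the two labels, a free one meets only an entry 0, and the range
      \<open>{0}\<close> gives 1.\<close>
    have factor: "?f ?x p = ?f (ut_part n (1\<^sub>m n)) p * ?t p" if p: "p \<in> ?P" for p
    proof -
      obtain i j where [simp]: "p = (i, j)" by (cases p)
      \<comment> \<open>A nonzero entry has an arc of \<open>\<nu>\<close> weakly inside its
        position, hence weakly inside an arc of \<open>\<eta>\<close>. As pairs with different
        endpoints are excluded, that arc sits at \<open>p\<close>.\<close>
      have xp: "?x $$ p = arc_label \<nu> p" if inside: "arc_label \<eta> p \<noteq> 0 \<or> strictly_inside \<eta> p"
      proof (cases "?x $$ p = 0")
        case True
        show ?thesis
        proof (rule ccontr)
          assume "?x $$ p \<noteq> arc_label \<nu> p"
          then have "(i, j, arc_label \<nu> p) \<in> \<nu>" using True arc_label_nonzero_iff[OF nu(1), of i j] by simp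
          then show False using x(2) \<open>?x $$ p \<noteq> arc_label \<nu> p\<close> by simp
        qed
      next
        case nz: False
        obtain k l b where b: "(k, l, b) \<in> \<nu>" "i \<le> k" "l \<le> j"
          using x(3)[of i j] p nz by auto
        have "(k, l) = (i, j)"
        proof (rule ccontr)
          assume ne: "(k, l) \<noteq> (i, j)"
          obtain i' j' a where a: "(i', j', a) \<in> \<eta>" "i' \<le> i" "j \<le> j'"
            using inside
          proof
            assume "arc_label \<eta> p \<noteq> 0"
            then have "(i, j, arc_label \<eta> p) \<in> \<eta>" using arc_label_nonzero_iff[OF eta(1), of i j] by simp
            then show thesis using that by blast
          next
            assume "strictly_inside \<eta> p"
            then show thesis using that by (auto simp: strictly_inside_def)
          qed
          have "(i', j') \<noteq> (k, l)" "i' \<le> k" "l \<le> j'" using ne a b by auto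
          then show False using False a(1) b(1) fq_set_partitionD(1)[OF nu(1) b(1)] by blast
        qed
        then show ?thesis using x(2)[OF b(1)] arc_label_eq[OF nu(1) b(1)] by simp
      qed
      \<comment> \<open>An arc of \<open>\<nu>\<close> at \<open>p\<close> and the arc of
        \<open>\<eta>\<close> around it would form an excluded pair.\<close>
      have "arc_label \<nu> p = 0" if inside: "strictly_inside \<eta> p"
      proof (rule ccontr)
        assume "arc_label \<nu> p \<noteq> 0"
        then have "(i, j, arc_label \<nu> p) \<in> \<nu>" using arc_label_nonzero_iff[OF nu(1), of i j] by simp
        moreover obtain i' j' a where "(i', j', a) \<in> \<eta>" "i' \<le> i" "j \<le> j'" "(i', j') \<noteq> (i, j)"
          using inside by (auto simp: strictly_inside_def)
        moreover have "i < j" using p by simp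
        ultimately show False using False by blast
      qed
      then show ?thesis
        using xp zero_ut(2)[OF p] th0 by (auto simp: corner_range_def)
    qed
    have A: "?h ` ?A = {p \<in> ?P. arc_label \<eta> p \<noteq> 0 \<and> arc_label \<nu> p \<noteq> 0}"
    proof (intro equalityI subsetI)
      fix p assume "p \<in> ?h ` ?A"
      then obtain i j a b where [simp]: "p = (i, j)" and "(i, j, a) \<in> \<eta>" "(i, j, b) \<in> \<nu>" by auto
      then show "p \<in> {p \<in> ?P. arc_label \<eta> p \<noteq> 0 \<and> arc_label \<nu> p \<noteq> 0}"
        using fq_set_partitionD[OF eta(1)] fq_set_partitionD[OF nu(1)]
        by (simp add: arc_label_eq[OF eta(1)] arc_label_eq[OF nu(1)])
    next
      fix p assume p: "p \<in> {p \<in> ?P. arc_label \<eta> p \<noteq> 0 \<and> arc_label \<nu> p \<noteq> 0}"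
      obtain i j where [simp]: "p = (i, j)" by (cases p)
      have "(i, j, arc_label \<eta> p, arc_label \<nu> p) \<in> ?A"
        using p arc_label_nonzero_iff[OF eta(1), of i j] arc_label_nonzero_iff[OF nu(1), of i j] by simp
      then show "p \<in> ?h ` ?A" by (rule rev_image_eqI) simp
    qed
    have inj: "inj_on ?h ?A"
      using fq_set_partition_unique[OF eta(1)] fq_set_partition_unique[OF nu(1)]
      by (auto intro!: inj_onI)
    \<comment> \<open>Positions without an arc in both partitions contribute
      \<open>\<theta> 0\<close>, which is 1.\<close>
    have "prod ?t ?P = prod ?t (?h ` ?A)"
      unfolding A by (intro prod.mono_neutral_right) (auto simp: th0)
    also have "\<dots> = (\<Prod>(i, j, a, b)\<in>?A. \<theta> (a * b))"
      unfolding prod.reindex[OF inj]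
      by (intro prod.cong) (auto simp: arc_label_eq[OF eta(1)] arc_label_eq[OF nu(1)])
    finally have "prod (?f ?x) ?P = chi_nonnest n \<theta> \<eta> (1\<^sub>m n) * (\<Prod>(i, j, a, b)\<in>?A. \<theta> (a * b))"
      using chi_nonnest_eq_prod[OF theta_hom theta_nonzero eta zero_ut(1)] factor
      by (simp add: prod.distrib)
    then show ?thesis using False chi by simp
  qed
qed

end
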